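(* Solutions of all linear second order ordinary differential equations $u''(z)+h(z)u(z)=0$, with any $h$ holomorphic on an open set $\mathcal{U}\subset\mathbb{C}$, can be locally expressed through geodesic curves in the Kähler–Norden geometry of the four-dimensional pseudo-Riemannian Einstein manifold $\mathbb{M}_h^{\mathrm{KN}}$. More precisely: Let $\mathbb{R}\ni s\mapsto(x(s),\varPhi(s),y(s),\varPsi(s))\in\mathcal{H}_{\mathrm{KN}}$ be a geodesic curve with a real affine parameter $s$, let the open set $\mathcal{V}_0$ (the domain of the complex affine parameter $\upsilon$, see context) be convex, and let the path $\gamma_z^\circ$ in $\mathcal{V}_0$ be defined by $\upsilon(s)=s$. Then, inside the solutions $$u_{\mathtt{top}/\mathtt{bot}}(z)=\exp\left[\int_{\gamma_z}d\zeta\,X(\zeta)\,\frac{X'(\zeta)\mp\sqrt{[h(\zeta)-X^2(\zeta)]^2+[X'(\zeta)]^2}}{h(\zeta)-X^2(\zeta)}\right]$$ (upper sign for $\mathtt{top}$, lower sign for $\mathtt{bot}$), which build a general solution $u(z)=A\,u_{\mathtt{top}}(z)+B\,u_{\mathtt{bot}}(z)$ of $u''(z)+h(z)u(z)=0$ with arbitrary constants $A,B$, one can decompose holomorphic geodesic curves in explicit form as $X(z)=\Phi(x,y)+i\,\Psi(x,y)$, where $$x(s)=\mathrm{Re}[z(s)],\qquad y(s)=\mathrm{Im}[z(s)],$$ $$\Phi(x(s),y(s))=\varPhi(s)=\mathrm{Re}[\mathfrak{X}(s)]=\mathrm{Re}[X(z(s))],$$ $$\Psi(x(s),y(s))=\varPsi(s)=\mathrm{Im}[\mathfrak{X}(s)]=\mathrm{Im}[X(z(s))],$$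 and $\mathbb{R}\ni s\mapsto(z(s),\mathfrak{X}(s))\in\mathcal{H}_{\mathbb C}$ is a geodesic curve on $\mathbb{M}_h^{\mathbb C}$ with the holomorphic parameter $\upsilon$ restricted to the real axis.
   Context: Complex geometry. $\mathbb{M}_h^{\mathbb C}=(\mathcal{H}_{\mathbb C},G_h)$, with $\mathcal{H}_{\mathbb C}=\{(z,\mathfrak{X})\in\mathcal{U}\times(\mathbb{C}\setminus\{0\}):\mathfrak{X}^2\neq h(z)\}$ and holomorphic metric $G_h=\mathfrak{X}^{-2}\left[(h(z)-\mathfrak{X}^2)^2dz^2+d\mathfrak{X}^2\right]$. Its complex geodesics $\upsilon\mapsto(z(\upsilon),\mathfrak{X}(\upsilon))$, with complex affine parameter $\upsilon$, solve $\ddot Z^i+\Upsilon^i_{jk}(Z)\dot Z^j\dot Z^k=0$ with $\Upsilon^i_{jk}$ the holomorphic Christoffel symbols computed from $G_h$ by the usual formula, the dot being $d/d\upsilon$. Explicit form: one has open sets $\mathcal{V}_0\subset\mathbb{C}$, $0\in\mathcal{V}_0$, and $\mathcal{U}_0\subset\mathcal{U}$, $z_0=z(0)\in\mathcal{U}_0$, such that $\mathcal{V}_0\ni\upsilon\mapsto z(\upsilon)\in\mathcal{U}_0$ satisfies $\dot z(\upsilon)\neq0$, and one writes $\mathfrak{X}(\upsilon)=X(z(\upsilon))$; $X$ is the geodesic curve in explicit form, a holomorphic function on $\mathcal{U}_0$ with $h\neq X^2$ there, satisfying $$X''=\frac{3X^{2}+h}{X^{2}-h}\,\frac{[X']^{2}}{X}-\frac{h'X'}{X^{2}-h}+\frac{X^{4}-h^{2}}{X}.$$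 For the solutions $u_{\mathtt{top}/\mathtt{bot}}$ to build a general solution it is assumed that $[h-X^2]^2+[X']^2\not\equiv0$ on $\mathcal{U}_0$. The curve $\gamma_z$ in $\mathcal{U}_0$ goes from $z_0$ to $z$ and is the image, under a holomorphic function of $\upsilon$, of a path $\gamma_z^\circ$ in $\mathcal{V}_0$, parametrized as $\upsilon(s)$, $s\in[0,1]$, $\upsilon(0)=0$, with the affine parameter rescaled so that $\upsilon(1)=1$; one can take $\gamma_z$ to be the first coordinate $s\mapsto z(\upsilon(s))$ of the geodesic curve in question. Real geometry. Identify $\mathbb{R}^2\cong\mathbb{C}$ by $z=x+iy$, and write $h=h_{\Re}+ih_{\Im}$ (with $h_{\Re},h_{\Im}$ real functions of $(x,y)\in\mathcal{U}$ satisfying the Cauchy–Riemann equations). $\mathbb{M}_h^{\mathrm{KN}}=(\mathcal{H}_{\mathrm{KN}},\hat{\mathbf g}_h)$, with $\mathcal{H}_{\mathrm{KN}}=\{(x,\varPhi,y,\varPsi)\in\mathbb{R}^4:(x,y)\in\mathcal{U},\ \varPhi+i\varPsi\neq0,\ h(x,y)\neq(\varPhi+i\varPsi)^2\}$ and $$\hat{\mathbf g}_h=\frac{\Delta_-\left[\Delta_+^2+h_{\Re}^2-h_{\Im}^2\right]+4\varPhi\varPsi h_{\Re}h_{\Im}-2\Delta_+^2h_{\Re}}{\Delta_+^2}\left(dx^2-dy^2\right)-4\frac{\left[\varPhi h_{\Im}-\varPsi(\Delta_++h_{\Re})\right]\left[\varPsi h_{\Im}-\varPhi(\Delta_+-h_{\Re})\right]}{\Delta_+^2}dx\,dy+\frac{\Delta_-\left(d\varPhi^2-d\varPsi^2\right)+4\varPhi\varPsi\,d\varPhi\,d\varPsi}{\Delta_+^2},$$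 where $\Delta_\pm=\varPhi^2\pm\varPsi^2$; equivalently $\hat{\mathbf g}_h=\mathrm{Re}\,G_h$ with $z=x+iy$, $\mathfrak{X}=\varPhi+i\varPsi$. Geodesics of $\mathbb{M}_h^{\mathrm{KN}}$ are those of the Levi-Civita connection of $\hat{\mathbf g}_h$. Italic $\varPhi,\varPsi$ denote coordinates (and their $s$-dependence along the geodesic); upright $\Phi,\Psi$ denote real functions of $(x,y)$. *)

theory Defs
  imports "HOL-Complex_Analysis.Cauchy_Integral_Formula"
begin

section \<open>Christoffel symbols and geodesics in a global chart\<close>

text \<open>
  The definitions of this section are generic in the scalar field: over \<open>real\<close> they give the
  Levi-Civita connection of a pseudo-Riemannian metric, over \<open>complex\<close> (where \<^const>\<open>deriv\<close> is the
  complex derivative) the holomorphic connection of a holomorphic metric.  A metric is given by its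
  symmetric coefficient matrix \<open>g p $ i $ j\<close> at the point \<open>p\<close>.
\<close>

definition partial_deriv ::
    "'n::finite \<Rightarrow> ('a::real_normed_field ^ 'n \<Rightarrow> 'a) \<Rightarrow> 'a ^ 'n \<Rightarrow> 'a" where
  "partial_deriv k f p = deriv (\<lambda>t. f (p + t *s axis k 1)) 0"

definition christoffel ::
    "('a::real_normed_field ^ 'n \<Rightarrow> 'a ^ 'n ^ 'n) \<Rightarrow> 'a ^ 'n \<Rightarrow> 'n::finite \<Rightarrow> 'n \<Rightarrow> 'n \<Rightarrow> 'a" where
  "christoffel g p i j k =
     (\<Sum>l\<in>UNIV. matrix_inv (g p) $ i $ l *
        (partial_deriv j (\<lambda>q. g q $ l $ k) p + partial_deriv k (\<lambda>q. g q $ l $ j) p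
          - partial_deriv l (\<lambda>q. g q $ j $ k) p)) / 2"

text \<open>
  Affinely parametrized geodesics, with parameter (real or complex) ranging over the set \<open>S\<close>, which
  is open wherever this notion is used.
\<close>

definition geodesic_on ::
    "('a::real_normed_field ^ 'n \<Rightarrow> 'a ^ 'n ^ 'n) \<Rightarrow> ('a ^ 'n) set \<Rightarrow> 'a set \<Rightarrow>
     ('a \<Rightarrow> 'a ^ 'n::finite) \<Rightarrow> bool" where
  "geodesic_on g M S c \<longleftrightarrow>
     (\<forall>t\<in>S. c t \<in> M) \<and>
     (\<exists>v a. \<forall>t\<in>S. \<forall>i.
        ((\<lambda>s. c s $ i) has_field_derivative v t $ i) (at t) \<and>
        ((\<lambda>s. v s $ i) has_field_derivative a t $ i) (at t) \<and>
        a t $ i + (\<Sum>j\<in>UNIV. \<Sum>k\<in>UNIV. christoffel g (c t) i j k * v t $ j * v t $ k) = 0)"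


section \<open>The holomorphic metric\<close>

text \<open>Coordinates on \<open>complex ^ 2\<close>: index \<open>1\<close> is \<open>z\<close>, index \<open>2\<close> is \<open>\<XX>\<close>.\<close>

definition H_C :: "complex set \<Rightarrow> (complex \<Rightarrow> complex) \<Rightarrow> (complex ^ 2) set" where
  "H_C U h = {p. p $ 1 \<in> U \<and> p $ 2 \<noteq> 0 \<and> (p $ 2)\<^sup>2 \<noteq> h (p $ 1)}"

definition G_C :: "(complex \<Rightarrow> complex) \<Rightarrow> complex ^ 2 \<Rightarrow> complex ^ 2 ^ 2" where
  "G_C h p = vector [vector [(h (p $ 1) - (p $ 2)\<^sup>2)\<^sup>2 / (p $ 2)\<^sup>2, 0],
                     vector [0, 1 / (p $ 2)\<^sup>2]]"


section \<open>The real Kaehler-Norden metric\<close>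

text \<open>
  Coordinates on \<open>real ^ 4\<close> in the order \<open>(x, \<phi>, y, \<psi>)\<close>.  A mixed term \<open>c dx dy\<close> of the line
  element contributes \<open>c / 2\<close> to each of the two off-diagonal matrix entries.
\<close>

definition H_KN :: "complex set \<Rightarrow> (complex \<Rightarrow> complex) \<Rightarrow> (real ^ 4) set" where
  "H_KN U h = {p. Complex (p $ 1) (p $ 3) \<in> U \<and> Complex (p $ 2) (p $ 4) \<noteq> 0 \<and>
                  h (Complex (p $ 1) (p $ 3)) \<noteq> (Complex (p $ 2) (p $ 4))\<^sup>2}"

definition g_KN :: "(complex \<Rightarrow> complex) \<Rightarrow> real ^ 4 \<Rightarrow> real ^ 4 ^ 4" where
  "g_KN h p =
    (let \<phi> = p $ 2; \<psi> = p $ 4;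
         hr = Re (h (Complex (p $ 1) (p $ 3))); hi = Im (h (Complex (p $ 1) (p $ 3)));
         Dp = \<phi>\<^sup>2 + \<psi>\<^sup>2; Dm = \<phi>\<^sup>2 - \<psi>\<^sup>2;
         a = (Dm * (Dp\<^sup>2 + hr\<^sup>2 - hi\<^sup>2) + 4 * \<phi> * \<psi> * hr * hi - 2 * Dp\<^sup>2 * hr) / Dp\<^sup>2;
         b = - 4 * ((\<phi> * hi - \<psi> * (Dp + hr)) * (\<psi> * hi - \<phi> * (Dp - hr))) / Dp\<^sup>2;
         c = Dm / Dp\<^sup>2;
         d = 4 * \<phi> * \<psi> / Dp\<^sup>2
     in vector [vector [a,     0,     b / 2, 0],
                vector [0,     c,     0,     d / 2],
                vector [b / 2, 0,     - a,   0],
                vector [0,     d / 2, 0,     - c]])"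

definition kn_point :: "real \<Rightarrow> real \<Rightarrow> real \<Rightarrow> real \<Rightarrow> real ^ 4" where
  "kn_point x \<phi> y \<psi> = vector [x, \<phi>, y, \<psi>]"

definition c_point :: "complex \<Rightarrow> complex \<Rightarrow> complex ^ 2" where
  "c_point z \<XX> = vector [z, \<XX>]"

lemma vector_4_nth [simp]:
  "(vector [w, x, y, z] :: 'a::zero ^ 4) $ 1 = w"
  "(vector [w, x, y, z] :: 'a::zero ^ 4) $ 2 = x"
  "(vector [w, x, y, z] :: 'a::zero ^ 4) $ 3 = y"
  "(vector [w, x, y, z] :: 'a::zero ^ 4) $ 4 = z"
  by (simp_all add: vector_def)

text \<open>The real metric is the real part of the holomorphic one.\<close>

lemma g_KN_eq_Re_G_C:
  fixes v :: "real ^ 4"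
  assumes "p \<in> H_KN U h"
  defines "P \<equiv> c_point (Complex (p $ 1) (p $ 3)) (Complex (p $ 2) (p $ 4))"
      and "w \<equiv> c_point (Complex (v $ 1) (v $ 3)) (Complex (v $ 2) (v $ 4))"
  shows "(\<Sum>i\<in>UNIV. \<Sum>j\<in>UNIV. g_KN h p $ i $ j * v $ i * v $ j) =
         Re (\<Sum>i\<in>UNIV. \<Sum>j\<in>UNIV. G_C h P $ i $ j * w $ i * w $ j)"
proof -
  define z where "z = Complex (p $ 1) (p $ 3)"
  define \<xx> where "\<xx> = Complex (p $ 2) (p $ 4)"
  define D where "D = (p $ 2)\<^sup>2 + (p $ 4)\<^sup>2"
  have "\<xx> \<noteq> 0" using assms(1) by (simp add: H_KN_def \<xx>_def)
  hence D: "D \<noteq> 0" unfolding D_def \<xx>_def by (simp add: complex_eq_iff sum_power2_eq_zero_iff)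
  have inv: "1 / \<xx> = Complex (p $ 2 / D) (- p $ 4 / D)"
    using \<open>\<xx> \<noteq> 0\<close> by (simp add: complex_eq_iff \<xx>_def D_def Re_divide Im_divide)
  have "(h z - \<xx>\<^sup>2)\<^sup>2 / \<xx>\<^sup>2 = (h z * (1 / \<xx>) - \<xx>)\<^sup>2"
    using \<open>\<xx> \<noteq> 0\<close> by (simp add: field_simps power2_eq_square)
  hence A: "(h z - \<xx>\<^sup>2)\<^sup>2 / \<xx>\<^sup>2 = (h z * Complex (p $ 2 / D) (- p $ 4 / D) - \<xx>)\<^sup>2"
    by (simp only: inv)
  have B: "1 / \<xx>\<^sup>2 = (Complex (p $ 2 / D) (- p $ 4 / D))\<^sup>2"
    by (simp only: inv[symmetric] power_divide power_one)
  have Re_G: "Re (\<Sum>i\<in>UNIV. \<Sum>j\<in>UNIV. G_C h P $ i $ j * w $ i * w $ j) =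
        Re ((h z * Complex (p $ 2 / D) (- p $ 4 / D) - \<xx>)\<^sup>2 * (Complex (v $ 1) (v $ 3))\<^sup>2
            + (Complex (p $ 2 / D) (- p $ 4 / D))\<^sup>2 * (Complex (v $ 2) (v $ 4))\<^sup>2)"
    unfolding A[symmetric] B[symmetric]
    by (simp add: P_def w_def G_C_def c_point_def sum_2 z_def \<xx>_def power2_eq_square mult.assoc)
  define hr where "hr = Re (h z)"
  define hi where "hi = Im (h z)"
  have hz: "h z = Complex hr hi" by (simp add: hr_def hi_def)
  show ?thesis
    unfolding Re_G hz
    using D
    apply (simp add: g_KN_def Let_def sum_4 flip: z_def)
    apply (simp add: hz \<xx>_def power2_eq_square flip: D_def[unfolded power2_eq_square])
    apply (simp add: divide_simps)
    apply (simp add: D_def power2_eq_square)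
    apply algebra
    done
qed

definition kn_geodesic ::
    "(complex \<Rightarrow> complex) \<Rightarrow> complex set \<Rightarrow> real set \<Rightarrow>
     (real \<Rightarrow> real) \<Rightarrow> (real \<Rightarrow> real) \<Rightarrow> (real \<Rightarrow> real) \<Rightarrow> (real \<Rightarrow> real) \<Rightarrow> bool" where
  "kn_geodesic h U J x \<phi> y \<psi> \<longleftrightarrow>
     open J \<and> is_interval J \<and> 0 \<in> J \<and>
     geodesic_on (g_KN h) (H_KN U h) J (\<lambda>s. kn_point (x s) (\<phi> s) (y s) (\<psi> s))"


section \<open>Complex geodesics in explicit form\<close>

text \<open>
  The curve \<open>\<upsilon> \<mapsto> (Z \<upsilon>, \<XX> \<upsilon>)\<close>, \<open>\<upsilon> \<in> V0\<close>, is written as the graph of \<open>X\<close> over \<open>U0\<close>.  Bijectivity of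
  \<open>Z\<close> onto \<open>U0\<close> is what makes the curves \<open>\<gamma>\<^sub>z\<close> below (and hence functions defined by integration
  along them) well-defined for each \<open>z \<in> U0\<close>.
\<close>

definition explicit_geodesic ::
    "(complex \<Rightarrow> complex) \<Rightarrow> complex set \<Rightarrow> complex set \<Rightarrow> complex set \<Rightarrow>
     (complex \<Rightarrow> complex) \<Rightarrow> (complex \<Rightarrow> complex) \<Rightarrow> (complex \<Rightarrow> complex) \<Rightarrow> bool" where
  "explicit_geodesic h U V0 U0 Z \<XX> X \<longleftrightarrow>
     open V0 \<and> 0 \<in> V0 \<and> open U0 \<and> U0 \<subseteq> U \<and>
     geodesic_on (G_C h) (H_C U h) V0 (\<lambda>\<upsilon>. c_point (Z \<upsilon>) (\<XX> \<upsilon>)) \<and>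
     (\<forall>\<upsilon>\<in>V0. deriv Z \<upsilon> \<noteq> 0) \<and> bij_betw Z V0 U0 \<and>
     X holomorphic_on U0 \<and> (\<forall>\<upsilon>\<in>V0. \<XX> \<upsilon> = X (Z \<upsilon>))"

text \<open>The complex and the real geodesic start at the same point with the same velocity.\<close>

definition same_initial_data ::
    "(complex \<Rightarrow> complex) \<Rightarrow> (complex \<Rightarrow> complex) \<Rightarrow>
     (real \<Rightarrow> real) \<Rightarrow> (real \<Rightarrow> real) \<Rightarrow> (real \<Rightarrow> real) \<Rightarrow> (real \<Rightarrow> real) \<Rightarrow> bool" where
  "same_initial_data Z \<XX> x \<phi> y \<psi> \<longleftrightarrow>
     Z 0 = Complex (x 0) (y 0) \<and> deriv Z 0 = Complex (deriv x 0) (deriv y 0) \<and>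
     \<XX> 0 = Complex (\<phi> 0) (\<psi> 0) \<and> deriv \<XX> 0 = Complex (deriv \<phi> 0) (deriv \<psi> 0)"


section \<open>Solutions built from a complex geodesic\<close>

definition solves_ode ::
    "(complex \<Rightarrow> complex) \<Rightarrow> complex set \<Rightarrow> (complex \<Rightarrow> complex) \<Rightarrow> bool" where
  "solves_ode h U0 u \<longleftrightarrow>
     u holomorphic_on U0 \<and> (\<forall>z\<in>U0. deriv (deriv u) z + h z * u z = 0)"

text \<open>
  The curve \<open>\<gamma>\<^sub>z\<close> from \<open>Z 0\<close> to \<open>z\<close>.  With \<open>w\<close> the parameter value at which \<open>Z\<close> reaches \<open>z\<close>,
  the geodesic with rescaled affine parameter \<open>\<upsilon> \<mapsto> Z (w * \<upsilon>)\<close> reaches \<open>z\<close> at \<open>\<upsilon> = 1\<close>, and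
  \<open>\<gamma>\<^sub>z\<close> is its image of the path \<open>\<upsilon>(s) = s\<close>, \<open>0 \<le> s \<le> 1\<close>.
\<close>

definition geodesic_path ::
    "complex set \<Rightarrow> (complex \<Rightarrow> complex) \<Rightarrow> complex \<Rightarrow> real \<Rightarrow> complex" where
  "geodesic_path V0 Z z = (\<lambda>s. Z (inv_into V0 Z z * of_real s))"

definition discr ::
    "(complex \<Rightarrow> complex) \<Rightarrow> (complex \<Rightarrow> complex) \<Rightarrow> complex \<Rightarrow> complex" where
  "discr h X z = (h z - (X z)\<^sup>2)\<^sup>2 + (deriv X z)\<^sup>2"

text \<open>
  The square root in the integrand is a holomorphic branch \<open>R\<close> on \<open>U0\<close>; the principal branch
  \<^const>\<open>csqrt\<close> would in general be discontinuous along \<open>\<gamma>\<^sub>z\<close>.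
\<close>

definition sqrt_branch ::
    "(complex \<Rightarrow> complex) \<Rightarrow> complex set \<Rightarrow> (complex \<Rightarrow> complex) \<Rightarrow> (complex \<Rightarrow> complex) \<Rightarrow> bool"
  where
  "sqrt_branch h U0 X R \<longleftrightarrow> R holomorphic_on U0 \<and> (\<forall>z\<in>U0. (R z)\<^sup>2 = discr h X z)"

definition u_top ::
    "(complex \<Rightarrow> complex) \<Rightarrow> (complex \<Rightarrow> complex) \<Rightarrow> (complex \<Rightarrow> complex) \<Rightarrow>
     (complex \<Rightarrow> real \<Rightarrow> complex) \<Rightarrow> complex \<Rightarrow> complex" where
  "u_top h X R \<gamma> z =
     exp (contour_integral (\<gamma> z) (\<lambda>\<zeta>. X \<zeta> * ((deriv X \<zeta> - R \<zeta>) / (h \<zeta> - (X \<zeta>)\<^sup>2))))"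

definition u_bot ::
    "(complex \<Rightarrow> complex) \<Rightarrow> (complex \<Rightarrow> complex) \<Rightarrow> (complex \<Rightarrow> complex) \<Rightarrow>
     (complex \<Rightarrow> real \<Rightarrow> complex) \<Rightarrow> complex \<Rightarrow> complex" where
  "u_bot h X R \<gamma> z =
     exp (contour_integral (\<gamma> z) (\<lambda>\<zeta>. X \<zeta> * ((deriv X \<zeta> + R \<zeta>) / (h \<zeta> - (X \<zeta>)\<^sup>2))))"

end

theory Submission
  imports Defs "HOL-Complex_Analysis.Conformal_Mappings"
begin

text \<open>
  The Christoffel symbols of \<open>Re G\<close> are the real and imaginary parts of those of \<open>G\<close>, so a real
  geodesic is a solution, with real time, of the complex geodesic equations; by uniqueness for
  ordinary differential equations it is the restriction to the real axis of the holomorphic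
  geodesic with the same initial data.  Eliminating the parameter from the geodesic equations
  gives the equation for \<open>X\<close>, which implies that both functions \<open>f = X (X' \<mp> R) / (h - X\<^sup>2)\<close>,
  with \<open>R\<^sup>2 = (h - X\<^sup>2)\<^sup>2 + X'\<^sup>2\<close>, solve the Riccati equation \<open>f' + f\<^sup>2 + h = 0\<close>, so that
  \<open>exp (\<integral> f)\<close> solves \<open>u'' + h u = 0\<close>.  The discriminant \<open>R\<^sup>2\<close> itself
  solves a linear first order equation: it vanishes identically or nowhere, has a holomorphic square
  root on the simply connected \<open>U0\<close>, and in the second case the Wronskian of the two solutions is
  nonzero.
\<close>

section \<open>Geodesic equations of the two metrics\<close>

text \<open>The discriminant has a geometric meaning: along an explicit geodesic with velocity
  \<open>(v, X' * v)\<close> the squared length of the velocity under \<open>G_C\<close> is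
  \<open>v\<^sup>2 * discr / X\<^sup>2\<close>, and this length is conserved. Hence the dichotomy of
  the overview separates null geodesics from the others, and the logarithmic derivative of
  \<open>R\<close> is that of \<open>X / v\<close>, which is where \<open>sqrt_rate\<close> comes
  from. The two functions \<open>f\<close> have product \<open>- X\<^sup>2\<close>, and their
  difference is \<open>2 * X * R / (h - X\<^sup>2)\<close> up to sign. Uniqueness is needed only
  along real time, existence on a complex disc. So real and complex geodesics are written as
  integral curves of one vector field on \<open>complex ^ 4\<close> and compared by a uniqueness
  theorem for a real variable, while existence comes from a Picard iteration in a complex variable.
  Convexity of \<open>V0\<close> serves several purposes: the real times common to both curves form
  an interval, the segments from 0 that are integrated over stay in \<open>V0\<close>, and
  holomorphic functions on \<open>V0\<close> have primitives. \<open>U0\<close> is merely the image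
  of \<open>V0\<close>, so primitives on it are transported along \<open>Z\<close>.\<close>

lemma matrix_inv_unique:
  fixes A :: "'a::semiring_1^'n^'m"
  assumes "A ** B = mat 1" "B ** A = mat 1"
  shows "matrix_inv A = B"
proof -
  have "A ** matrix_inv A = mat 1 \<and> matrix_inv A ** A = mat 1"
    unfolding matrix_inv_def using assms by (rule_tac someI[of _ B]) simp
  then have "matrix_inv A = (B ** A) ** matrix_inv A" and "A ** matrix_inv A = mat 1"
    using assms by simp_all
  then show ?thesis by (simp add: matrix_mul_assoc[symmetric])
qed

text \<open>The second derivative of the first coordinate along a geodesic of \<open>G_C\<close> at
  position \<open>(z, X)\<close> with velocity \<open>(v, w)\<close>, that is, minus the contracted
  Christoffel symbols; \<open>accel_X\<close> is the same for the second coordinate.\<close>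

definition accel_z :: "(complex \<Rightarrow> complex) \<Rightarrow> complex \<Rightarrow> complex \<Rightarrow> complex \<Rightarrow> complex \<Rightarrow> complex" where
  "accel_z h z X v w = 2 * (h z + X\<^sup>2) / (X * (h z - X\<^sup>2)) * v * w - deriv h z / (h z - X\<^sup>2) * v\<^sup>2"

definition accel_X :: "(complex \<Rightarrow> complex) \<Rightarrow> complex \<Rightarrow> complex \<Rightarrow> complex \<Rightarrow> complex \<Rightarrow> complex" where
  "accel_X h z X v w = w\<^sup>2 / X - ((h z)\<^sup>2 - X ^ 4) / X * v\<^sup>2"

definition coef_z :: "(complex \<Rightarrow> complex) \<Rightarrow> complex \<Rightarrow> complex \<Rightarrow> complex" where
  "coef_z h z X = (h z - X\<^sup>2)\<^sup>2 / X\<^sup>2"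

text \<open>The derivatives are taken at 0 of shifted functions because \<open>partial_deriv\<close>
  has this shape; both metrics are differentiated through these three facts.\<close>

lemma coef_z_DERIV:
  assumes "h field_differentiable at z" "X \<noteq> 0"
  shows "((\<lambda>t. coef_z h (z + t) X) has_field_derivative 2 * (h z - X\<^sup>2) * deriv h z / X\<^sup>2) (at 0)"
    and "((\<lambda>t. coef_z h z (X + t)) has_field_derivative - 2 * (h z - X\<^sup>2) * (h z + X\<^sup>2) / X ^ 3) (at 0)"
    and "((\<lambda>t. 1 / (X + t)\<^sup>2) has_field_derivative - 2 / X ^ 3) (at 0)"
proof -
  have "(h has_field_derivative deriv h z) (at (z + 0))"
    using assms(1) by (simp add: DERIV_deriv_iff_field_differentiable)
  then have *: "((\<lambda>t. h (z + t)) has_field_derivative deriv h z) (at 0)"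
    using DERIV_shift[of h "deriv h z" 0 z] by (simp add: add.commute)
  show "((\<lambda>t. coef_z h (z + t) X) has_field_derivative 2 * (h z - X\<^sup>2) * deriv h z / X\<^sup>2) (at 0)"
    unfolding coef_z_def
    by (rule DERIV_cong[OF DERIV_cdivide[OF DERIV_power[OF DERIV_diff[OF * DERIV_const]]]])
       (simp add: algebra_simps)
  show "((\<lambda>t. coef_z h z (X + t)) has_field_derivative - 2 * (h z - X\<^sup>2) * (h z + X\<^sup>2) / X ^ 3) (at 0)"
    unfolding coef_z_def using assms(2)
    by (auto intro!: derivative_eq_intros simp: divide_simps) algebra
  show "((\<lambda>t. 1 / (X + t)\<^sup>2) has_field_derivative - 2 / X ^ 3) (at 0)"
    using assms(2)
    by (auto intro!: derivative_eq_intros simp: divide_simps) algebra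
qed

lemma G_C_entries:
  "G_C h p $ 1 $ 1 = coef_z h (p $ 1) (p $ 2)" "G_C h p $ 1 $ 2 = 0"
  "G_C h p $ 2 $ 1 = 0" "G_C h p $ 2 $ 2 = 1 / (p $ 2)\<^sup>2"
  by (simp_all add: G_C_def coef_z_def)

text \<open>The metric is diagonal, so only derivatives of the two diagonal entries enter, and the
  second entry does not depend on z. What remains is rational algebra.\<close>

lemma christoffel_G_C:
  fixes v :: "complex ^ 2"
  assumes "open U" "h holomorphic_on U" "p \<in> H_C U h"
  shows "(\<Sum>j\<in>UNIV. \<Sum>k\<in>UNIV. christoffel (G_C h) p 1 j k * v $ j * v $ k) =
           - accel_z h (p $ 1) (p $ 2) (v $ 1) (v $ 2)"
    and "(\<Sum>j\<in>UNIV. \<Sum>k\<in>UNIV. christoffel (G_C h) p 2 j k * v $ j * v $ k) =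
           - accel_X h (p $ 1) (p $ 2) (v $ 1) (v $ 2)"
proof -
  define z X where "z = p $ 1" and "X = p $ 2"
  have nz: "X \<noteq> 0" "h z - X\<^sup>2 \<noteq> 0" "z \<in> U" using assms(3) by (auto simp: H_C_def z_def X_def)
  have h: "h field_differentiable at z"
    using assms(1,2) nz by (auto intro: holomorphic_on_imp_differentiable_at)
  have inv: "matrix_inv (G_C h p) = vector [vector [1 / coef_z h z X, 0], vector [0, X\<^sup>2]]"
    by (rule matrix_inv_unique)
       (use nz in \<open>simp_all add: vec_eq_iff forall_2 matrix_matrix_mult_def sum_2 mat_def G_C_entries
          z_def[symmetric] X_def[symmetric] coef_z_def\<close>)
  have pd: "partial_deriv 1 (\<lambda>q. G_C h q $ 1 $ 1) p = 2 * (h z - X\<^sup>2) * deriv h z / X\<^sup>2"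
    "partial_deriv 2 (\<lambda>q. G_C h q $ 1 $ 1) p = - 2 * (h z - X\<^sup>2) * (h z + X\<^sup>2) / X ^ 3"
    "partial_deriv 1 (\<lambda>q. G_C h q $ 2 $ 2) p = 0"
    "partial_deriv 2 (\<lambda>q. G_C h q $ 2 $ 2) p = - 2 / X ^ 3"
    "\<And>k. partial_deriv k (\<lambda>q. G_C h q $ 1 $ 2) p = 0"
    "\<And>k. partial_deriv k (\<lambda>q. G_C h q $ 2 $ 1) p = 0"
    unfolding partial_deriv_def G_C_entries
    using coef_z_DERIV[OF h nz(1), THEN DERIV_imp_deriv]
    by (simp_all add: axis_def z_def X_def)
  show "(\<Sum>j\<in>UNIV. \<Sum>k\<in>UNIV. christoffel (G_C h) p 1 j k * v $ j * v $ k) =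
           - accel_z h (p $ 1) (p $ 2) (v $ 1) (v $ 2)"
    using nz
    by (simp add: christoffel_def sum_2 inv pd accel_z_def coef_z_def flip: z_def X_def)
       (simp add: divide_simps, algebra)
  show "(\<Sum>j\<in>UNIV. \<Sum>k\<in>UNIV. christoffel (G_C h) p 2 j k * v $ j * v $ k) =
           - accel_X h (p $ 1) (p $ 2) (v $ 1) (v $ 2)"
    using nz
    by (simp add: christoffel_def sum_2 inv pd accel_X_def coef_z_def flip: z_def X_def)
       (simp add: divide_simps, algebra)
qed


section \<open>The real metric as the real part of a holomorphic quadratic form\<close>

abbreviation kn_z :: "real ^ 4 \<Rightarrow> complex" where "kn_z p \<equiv> Complex (p $ 1) (p $ 3)"
abbreviation kn_X :: "real ^ 4 \<Rightarrow> complex" where "kn_X p \<equiv> Complex (p $ 2) (p $ 4)"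

lemma Complex_inverse_square:
  "1 / (Complex a b)\<^sup>2 = Complex ((a\<^sup>2 - b\<^sup>2) / (a\<^sup>2 + b\<^sup>2)\<^sup>2) (- 2 * a * b / (a\<^sup>2 + b\<^sup>2)\<^sup>2)"
proof -
  have "(a\<^sup>2 - b\<^sup>2)\<^sup>2 + (2 * a * b)\<^sup>2 = (a\<^sup>2 + b\<^sup>2)\<^sup>2" by algebra
  then show ?thesis
    by (simp add: complex_eq_iff Re_divide Im_divide power2_eq_square algebra_simps)
qed

text \<open>No assumption \<open>kn_X q \<noteq> 0\<close>: division by zero makes both sides vanish there.\<close>

lemma g_KN_entries:
  fixes q :: "real ^ 4"
  shows "g_KN h q $ 1 $ 1 = Re (coef_z h (kn_z q) (kn_X q))"
    "g_KN h q $ 1 $ 3 = - Im (coef_z h (kn_z q) (kn_X q))"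
    "g_KN h q $ 3 $ 1 = - Im (coef_z h (kn_z q) (kn_X q))"
    "g_KN h q $ 3 $ 3 = - Re (coef_z h (kn_z q) (kn_X q))"
    "g_KN h q $ 2 $ 2 = Re (1 / (kn_X q)\<^sup>2)"
    "g_KN h q $ 2 $ 4 = - Im (1 / (kn_X q)\<^sup>2)"
    "g_KN h q $ 4 $ 2 = - Im (1 / (kn_X q)\<^sup>2)"
    "g_KN h q $ 4 $ 4 = - Re (1 / (kn_X q)\<^sup>2)"
    "g_KN h q $ 1 $ 2 = 0" "g_KN h q $ 2 $ 1 = 0" "g_KN h q $ 1 $ 4 = 0" "g_KN h q $ 4 $ 1 = 0"
    "g_KN h q $ 3 $ 2 = 0" "g_KN h q $ 2 $ 3 = 0" "g_KN h q $ 3 $ 4 = 0" "g_KN h q $ 4 $ 3 = 0"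
proof -
  define hr hi a b D where "hr = Re (h (kn_z q))" and "hi = Im (h (kn_z q))"
    and "a = q $ 2" and "b = q $ 4" and "D = a\<^sup>2 + b\<^sup>2"
  have hz: "h (kn_z q) = Complex hr hi" by (simp add: hr_def hi_def)
  define W where "W = (Complex hr hi - (Complex a b)\<^sup>2)\<^sup>2"
  \<comment> \<open>\<open>Complex u w\<close> is the square of the conjugate of
    \<open>kn_X q\<close>, and \<open>D\<close> its squared modulus, so dividing by the square of
    \<open>kn_X q\<close> is multiplying by \<open>Complex u w\<close> over
    \<open>D\<^sup>2\<close>.\<close>
  define u w where "u = a\<^sup>2 - b\<^sup>2" and "w = - 2 * a * b"
  have "coef_z h (kn_z q) (kn_X q) = W * Complex (u / D\<^sup>2) (w / D\<^sup>2)"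
    unfolding coef_z_def D_def hz u_def w_def W_def Complex_inverse_square[symmetric]
    by (simp add: a_def b_def)
  then have A: "Re (coef_z h (kn_z q) (kn_X q)) = (Re W * u - Im W * w) / D\<^sup>2"
    "Im (coef_z h (kn_z q) (kn_X q)) = (Re W * w + Im W * u) / D\<^sup>2"
    by (simp_all add: diff_divide_distrib add_divide_distrib)
  have W: "Re W = (hr - (a\<^sup>2 - b\<^sup>2))\<^sup>2 - (hi - 2 * a * b)\<^sup>2" "Im W = 2 * (hr - (a\<^sup>2 - b\<^sup>2)) * (hi - 2 * a * b)"
    by (simp_all add: W_def power2_eq_square algebra_simps)
  have re: "Re W * u - Im W * w = u * (D\<^sup>2 + hr\<^sup>2 - hi\<^sup>2) + 4 * a * b * hr * hi - 2 * D\<^sup>2 * hr"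
    unfolding W u_def w_def D_def by algebra
  \<comment> \<open>The right-hand side is chosen to match \<open>g_KN\<close>: half of the mixed
    coefficient there is minus this expression over \<open>D\<^sup>2\<close>.\<close>
  have im: "Re W * w + Im W * u = 2 * ((a * hi - b * (D + hr)) * (b * hi - a * (D - hr)))"
    unfolding W u_def w_def D_def by algebra
  show "g_KN h q $ 1 $ 1 = Re (coef_z h (kn_z q) (kn_X q))"
    "g_KN h q $ 3 $ 3 = - Re (coef_z h (kn_z q) (kn_X q))"
    "g_KN h q $ 1 $ 3 = - Im (coef_z h (kn_z q) (kn_X q))"
    "g_KN h q $ 3 $ 1 = - Im (coef_z h (kn_z q) (kn_X q))"
    unfolding A re im
    by (simp_all add: g_KN_def Let_def flip: hr_def hi_def a_def b_def D_def u_def)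
  show "g_KN h q $ 2 $ 2 = Re (1 / (kn_X q)\<^sup>2)"
    "g_KN h q $ 2 $ 4 = - Im (1 / (kn_X q)\<^sup>2)"
    "g_KN h q $ 4 $ 2 = - Im (1 / (kn_X q)\<^sup>2)"
    "g_KN h q $ 4 $ 4 = - Re (1 / (kn_X q)\<^sup>2)"
    unfolding Complex_inverse_square by (simp_all add: g_KN_def Let_def)
qed (simp_all add: g_KN_def Let_def)

text \<open>With \<open>d = 1\<close> and \<open>d = \<i>\<close> these are the Cauchy-Riemann
  equations. The negated versions serve the metric entries that carry a minus sign.\<close>

lemma Re_Im_deriv_along:
  assumes "(f has_field_derivative D) (at 0)"
  shows "deriv (\<lambda>t. Re (f (complex_of_real t * d))) 0 = Re (D * d)"
    and "deriv (\<lambda>t. Im (f (complex_of_real t * d))) 0 = Im (D * d)"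
    and "deriv (\<lambda>t. - Re (f (complex_of_real t * d))) 0 = - Re (D * d)"
    and "deriv (\<lambda>t. - Im (f (complex_of_real t * d))) 0 = - Im (D * d)"
proof -
  have "((\<lambda>t. complex_of_real t * d) has_vector_derivative d) (at 0)"
    by (auto intro!: derivative_eq_intros)
  then have "(f \<circ> (\<lambda>t. complex_of_real t * d) has_vector_derivative d * D) (at 0)"
    by (rule field_vector_diff_chain_at) (simp add: assms)
  then have *: "((\<lambda>t. f (complex_of_real t * d)) has_vector_derivative D * d) (at 0)"
    by (simp add: o_def mult.commute)
  show "deriv (\<lambda>t. Re (f (complex_of_real t * d))) 0 = Re (D * d)"
    using * by (intro DERIV_imp_deriv) (rule has_field_derivative_Re)
  show "deriv (\<lambda>t. Im (f (complex_of_real t * d))) 0 = Im (D * d)"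
    using * by (intro DERIV_imp_deriv) (rule has_field_derivative_Im)
  show "deriv (\<lambda>t. - Re (f (complex_of_real t * d))) 0 = - Re (D * d)"
    using * by (intro DERIV_imp_deriv DERIV_minus) (rule has_field_derivative_Re)
  show "deriv (\<lambda>t. - Im (f (complex_of_real t * d))) 0 = - Im (D * d)"
    using * by (intro DERIV_imp_deriv DERIV_minus) (rule has_field_derivative_Im)
qed

text \<open>Contracting with the velocity before raising the index means that only one lowered
  expression per \<open>l\<close> has to be computed, instead of all symbols of a four-dimensional
  metric.\<close>

lemma sum_sum_christoffel:
  fixes v :: "'a::real_normed_field ^ 'n::finite"
  shows "(\<Sum>j\<in>UNIV. \<Sum>k\<in>UNIV. christoffel g p i j k * v $ j * v $ k) =
    (\<Sum>l\<in>UNIV. matrix_inv (g p) $ i $ l * ((\<Sum>j\<in>UNIV. \<Sum>k\<in>UNIV.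
        (partial_deriv j (\<lambda>q. g q $ l $ k) p + partial_deriv k (\<lambda>q. g q $ l $ j) p
          - partial_deriv l (\<lambda>q. g q $ j $ k) p) * v $ j * v $ k) / 2))"
proof -
  have "christoffel g p i j k * v $ j * v $ k = (\<Sum>l\<in>UNIV. matrix_inv (g p) $ i $ l *
        ((partial_deriv j (\<lambda>q. g q $ l $ k) p + partial_deriv k (\<lambda>q. g q $ l $ j) p
          - partial_deriv l (\<lambda>q. g q $ j $ k) p) * v $ j * v $ k / 2))" for j k
    unfolding christoffel_def sum_divide_distrib sum_distrib_right
    by (rule sum.cong) (simp_all add: algebra_simps)
  then have "(\<Sum>j\<in>UNIV. \<Sum>k\<in>UNIV. christoffel g p i j k * v $ j * v $ k) =
    (\<Sum>j\<in>UNIV. \<Sum>k\<in>UNIV. \<Sum>l\<in>UNIV. matrix_inv (g p) $ i $ l *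
        ((partial_deriv j (\<lambda>q. g q $ l $ k) p + partial_deriv k (\<lambda>q. g q $ l $ j) p
          - partial_deriv l (\<lambda>q. g q $ j $ k) p) * v $ j * v $ k / 2))" by simp
  also have "\<dots> = (\<Sum>j\<in>UNIV. \<Sum>l\<in>UNIV. \<Sum>k\<in>UNIV. matrix_inv (g p) $ i $ l *
        ((partial_deriv j (\<lambda>q. g q $ l $ k) p + partial_deriv k (\<lambda>q. g q $ l $ j) p
          - partial_deriv l (\<lambda>q. g q $ j $ k) p) * v $ j * v $ k / 2))"
    by (intro sum.cong refl sum.swap)
  also have "\<dots> = (\<Sum>l\<in>UNIV. \<Sum>j\<in>UNIV. \<Sum>k\<in>UNIV. matrix_inv (g p) $ i $ l *
        ((partial_deriv j (\<lambda>q. g q $ l $ k) p + partial_deriv k (\<lambda>q. g q $ l $ j) p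
          - partial_deriv l (\<lambda>q. g q $ j $ k) p) * v $ j * v $ k / 2))"
    by (rule sum.swap)
  finally show ?thesis by (simp add: sum_distrib_left sum_divide_distrib)
qed

text \<open>On each index pair, 1 with 3 and 2 with 4, the metric acts as
  \<open>\<lambda>v. cnj (A * v)\<close> for a complex number \<open>A\<close>. The inverse of that
  map is \<open>\<lambda>w. cnj w / A\<close>, whose matrix is the block given here.\<close>

lemma matrix_inv_g_KN:
  assumes "p \<in> H_KN U h"
  defines "A' \<equiv> 1 / coef_z h (kn_z p) (kn_X p)" and "B' \<equiv> (kn_X p)\<^sup>2"
  shows "matrix_inv (g_KN h p) =
    vector [vector [Re A', 0, Im A', 0], vector [0, Re B', 0, Im B'],
            vector [Im A', 0, - Re A', 0], vector [0, Im B', 0, - Re B']]"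
proof -
  define A B where "A = coef_z h (kn_z p) (kn_X p)" and "B = 1 / (kn_X p)\<^sup>2"
  have "A * A' = 1" "B * B' = 1"
    using assms(1) by (simp_all add: A_def A'_def B_def B'_def coef_z_def H_KN_def del: Complex_eq_0)
  then have *: "Re A * Re A' - Im A * Im A' = 1" "Re A * Im A' + Im A * Re A' = 0"
    "Re B * Re B' - Im B * Im B' = 1" "Re B * Im B' + Im B * Re B' = 0"
    by (simp_all add: complex_eq_iff)
  show ?thesis
    by (rule matrix_inv_unique;
        simp add: vec_eq_iff forall_4 matrix_matrix_mult_def sum_4 mat_def g_KN_entries flip: A_def B_def;
        use * in \<open>auto simp: algebra_simps\<close>)
qed

text \<open>By the Cauchy-Riemann equations the lowered real symbols, paired up, are conjugates of
  the holomorphic ones. The inverse metric conjugates once more, so raising the index restores the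
  holomorphic expression.\<close>

lemma christoffel_g_KN:
  fixes v :: "real ^ 4"
  assumes "open U" "h holomorphic_on U" "p \<in> H_KN U h"
  defines "\<Gamma> \<equiv> \<lambda>i. \<Sum>j\<in>UNIV. \<Sum>k\<in>UNIV. christoffel (g_KN h) p i j k * v $ j * v $ k"
  shows "Complex (\<Gamma> 1) (\<Gamma> 3) = - accel_z h (kn_z p) (kn_X p) (kn_z v) (kn_X v)"
    and "Complex (\<Gamma> 2) (\<Gamma> 4) = - accel_X h (kn_z p) (kn_X p) (kn_z v) (kn_X v)"
proof -
  define z X where "z = kn_z p" and "X = kn_X p"
  have nz: "X \<noteq> 0" "h z - X\<^sup>2 \<noteq> 0" "z \<in> U" using assms(3) by (auto simp: H_KN_def z_def X_def)
  have h: "h field_differentiable at z"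
    using assms(1,2) nz by (auto intro: holomorphic_on_imp_differentiable_at)
  define A1 A2 B2 where "A1 = 2 * (h z - X\<^sup>2) * deriv h z / X\<^sup>2"
    and "A2 = - 2 * (h z - X\<^sup>2) * (h z + X\<^sup>2) / X ^ 3" and "B2 = - 2 / X ^ 3"
  \<comment> \<open>Moving along coordinate 3 or 4 is moving in direction \<open>\<i>\<close> in the
    complex coordinate, which makes \<open>Re_Im_deriv_along\<close> applicable.\<close>
  have line: "kn_z (p + t *s axis 1 1) = z + of_real t * 1" "kn_z (p + t *s axis 3 1) = z + of_real t * \<i>"
    "kn_z (p + t *s axis 2 1) = z" "kn_z (p + t *s axis 4 1) = z"
    "kn_X (p + t *s axis 2 1) = X + of_real t * 1" "kn_X (p + t *s axis 4 1) = X + of_real t * \<i>"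
    "kn_X (p + t *s axis 1 1) = X" "kn_X (p + t *s axis 3 1) = X" for t
    by (simp_all add: complex_eq_iff z_def X_def axis_def)
  note C = coef_z_DERIV[OF h nz(1), folded A1_def A2_def B2_def]
  note D = C[THEN Re_Im_deriv_along(1)] C[THEN Re_Im_deriv_along(2)]
    C[THEN Re_Im_deriv_along(3)] C[THEN Re_Im_deriv_along(4)]
  have pA: "partial_deriv 1 (\<lambda>q. Re (coef_z h (kn_z q) (kn_X q))) p = Re A1"
    "partial_deriv 3 (\<lambda>q. Re (coef_z h (kn_z q) (kn_X q))) p = - Im A1"
    "partial_deriv 2 (\<lambda>q. Re (coef_z h (kn_z q) (kn_X q))) p = Re A2"
    "partial_deriv 4 (\<lambda>q. Re (coef_z h (kn_z q) (kn_X q))) p = - Im A2"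
    "partial_deriv 1 (\<lambda>q. Im (coef_z h (kn_z q) (kn_X q))) p = Im A1"
    "partial_deriv 3 (\<lambda>q. Im (coef_z h (kn_z q) (kn_X q))) p = Re A1"
    "partial_deriv 2 (\<lambda>q. Im (coef_z h (kn_z q) (kn_X q))) p = Im A2"
    "partial_deriv 4 (\<lambda>q. Im (coef_z h (kn_z q) (kn_X q))) p = Re A2"
    "partial_deriv 1 (\<lambda>q. Re (1 / (kn_X q)\<^sup>2)) p = 0"
    "partial_deriv 3 (\<lambda>q. Re (1 / (kn_X q)\<^sup>2)) p = 0"
    "partial_deriv 2 (\<lambda>q. Re (1 / (kn_X q)\<^sup>2)) p = Re B2"
    "partial_deriv 4 (\<lambda>q. Re (1 / (kn_X q)\<^sup>2)) p = - Im B2"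
    "partial_deriv 1 (\<lambda>q. Im (1 / (kn_X q)\<^sup>2)) p = 0"
    "partial_deriv 3 (\<lambda>q. Im (1 / (kn_X q)\<^sup>2)) p = 0"
    "partial_deriv 2 (\<lambda>q. Im (1 / (kn_X q)\<^sup>2)) p = Im B2"
    "partial_deriv 4 (\<lambda>q. Im (1 / (kn_X q)\<^sup>2)) p = Re B2"
    unfolding partial_deriv_def line D by simp_all
  have pN: "partial_deriv 1 (\<lambda>q. - Re (coef_z h (kn_z q) (kn_X q))) p = - Re A1"
    "partial_deriv 3 (\<lambda>q. - Re (coef_z h (kn_z q) (kn_X q))) p = Im A1"
    "partial_deriv 2 (\<lambda>q. - Re (coef_z h (kn_z q) (kn_X q))) p = - Re A2"
    "partial_deriv 4 (\<lambda>q. - Re (coef_z h (kn_z q) (kn_X q))) p = Im A2"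
    "partial_deriv 1 (\<lambda>q. - Im (coef_z h (kn_z q) (kn_X q))) p = - Im A1"
    "partial_deriv 3 (\<lambda>q. - Im (coef_z h (kn_z q) (kn_X q))) p = - Re A1"
    "partial_deriv 2 (\<lambda>q. - Im (coef_z h (kn_z q) (kn_X q))) p = - Im A2"
    "partial_deriv 4 (\<lambda>q. - Im (coef_z h (kn_z q) (kn_X q))) p = - Re A2"
    "partial_deriv 1 (\<lambda>q. - Re (1 / (kn_X q)\<^sup>2)) p = 0"
    "partial_deriv 3 (\<lambda>q. - Re (1 / (kn_X q)\<^sup>2)) p = 0"
    "partial_deriv 2 (\<lambda>q. - Re (1 / (kn_X q)\<^sup>2)) p = - Re B2"
    "partial_deriv 4 (\<lambda>q. - Re (1 / (kn_X q)\<^sup>2)) p = Im B2"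
    "partial_deriv 1 (\<lambda>q. - Im (1 / (kn_X q)\<^sup>2)) p = 0"
    "partial_deriv 3 (\<lambda>q. - Im (1 / (kn_X q)\<^sup>2)) p = 0"
    "partial_deriv 2 (\<lambda>q. - Im (1 / (kn_X q)\<^sup>2)) p = - Im B2"
    "partial_deriv 4 (\<lambda>q. - Im (1 / (kn_X q)\<^sup>2)) p = - Re B2"
    unfolding partial_deriv_def line D by simp_all
  define A' B' where "A' = 1 / coef_z h (kn_z p) (kn_X p)" and "B' = (kn_X p)\<^sup>2"
  define a b where "a = kn_z v" and "b = kn_X v"
  have v: "v $ 1 = Re a" "v $ 3 = Im a" "v $ 2 = Re b" "v $ 4 = Im b" by (simp_all add: a_def b_def)
  define low where "low = (\<lambda>l. (\<Sum>j\<in>UNIV. \<Sum>k\<in>UNIV.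
        (partial_deriv j (\<lambda>q. g_KN h q $ l $ k) p + partial_deriv k (\<lambda>q. g_KN h q $ l $ j) p
          - partial_deriv l (\<lambda>q. g_KN h q $ j $ k) p) * v $ j * v $ k) / 2)"
  have p0: "partial_deriv k (\<lambda>q. 0) p = 0" for k :: 4 by (simp add: partial_deriv_def)
  \<comment> \<open>The Christoffel symbols of the first kind of \<open>G_C\<close>, contracted
    twice with the velocity \<open>(a, b)\<close>.\<close>
  define L1 L2 where "L1 = A1 / 2 * a\<^sup>2 + A2 * a * b" and "L2 = B2 / 2 * b\<^sup>2 - A2 / 2 * a\<^sup>2"
  have low: "low 1 = Re L1" "low 3 = - Im L1" "low 2 = Re L2" "low 4 = - Im L2"
    unfolding low_def sum_4 g_KN_entries pA pN p0 v L1_def L2_def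
    by (simp_all add: power2_eq_square) (simp_all add: field_simps)
  have \<Gamma>: "\<Gamma> i = (\<Sum>l\<in>UNIV. matrix_inv (g_KN h p) $ i $ l * low l)" for i
    unfolding \<Gamma>_def low_def by (rule sum_sum_christoffel)
  note inv = matrix_inv_g_KN[OF assms(3), folded A'_def B'_def]
  have "Complex (\<Gamma> 1) (\<Gamma> 3) = A' * L1"
    unfolding \<Gamma> by (simp add: sum_4 low inv complex_eq_iff)
  also have "\<dots> = - accel_z h z X a b"
    using nz unfolding A'_def L1_def coef_z_def A1_def A2_def accel_z_def z_def[symmetric] X_def[symmetric]
    by (simp add: divide_simps) algebra
  finally show "Complex (\<Gamma> 1) (\<Gamma> 3) = - accel_z h (kn_z p) (kn_X p) (kn_z v) (kn_X v)"
    by (simp add: z_def X_def a_def b_def)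
  have "Complex (\<Gamma> 2) (\<Gamma> 4) = B' * L2"
    unfolding \<Gamma> by (simp add: sum_4 low inv complex_eq_iff)
  also have "\<dots> = - accel_X h z X a b"
    using nz unfolding B'_def B2_def A2_def L2_def accel_X_def X_def[symmetric]
    by (simp add: divide_simps) algebra
  finally show "Complex (\<Gamma> 2) (\<Gamma> 4) = - accel_X h (kn_z p) (kn_X p) (kn_z v) (kn_X v)"
    by (simp add: z_def X_def a_def b_def)
qed

section \<open>Existence and uniqueness for ordinary differential equations\<close>

definition locally_lipschitz_at :: "('a::metric_space \<Rightarrow> 'b::metric_space) \<Rightarrow> 'a \<Rightarrow> bool" where
  "locally_lipschitz_at f p \<longleftrightarrow> (\<exists>e>0. \<exists>L. L-lipschitz_on (ball p e) f)"

lemma locally_lipschitz_at2: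
  assumes "locally_lipschitz_at f p" "locally_lipschitz_at g p"
  obtains e L M where "e > 0" "L-lipschitz_on (ball p e) f" "M-lipschitz_on (ball p e) g"
proof -
  obtain e1 e2 L M where "e1 > 0" "e2 > 0" "L-lipschitz_on (ball p e1) f" "M-lipschitz_on (ball p e2) g"
    using assms by (auto simp: locally_lipschitz_at_def)
  then show thesis
    by (intro that[of "min e1 e2" L M]) (auto elim!: lipschitz_on_subset)
qed

lemma locally_lipschitz_at_const: "locally_lipschitz_at (\<lambda>x. c) p"
  unfolding locally_lipschitz_at_def using lipschitz_on_constant zero_less_one by blast

lemma locally_lipschitz_at_nth: "locally_lipschitz_at (\<lambda>x::'a::real_normed_vector ^ 'n. x $ i) p"
proof -
  have "1-lipschitz_on (ball p 1) (\<lambda>x::'a ^ 'n. x $ i)"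
    by (rule lipschitz_onI) (auto simp: dist_vec_nth_le)
  then show ?thesis unfolding locally_lipschitz_at_def using zero_less_one by blast
qed

lemma locally_lipschitz_at_diff:
  fixes f g :: "'a::metric_space \<Rightarrow> 'b::real_normed_vector"
  assumes "locally_lipschitz_at f p" "locally_lipschitz_at g p"
  shows "locally_lipschitz_at (\<lambda>x. f x - g x) p"
  using assms by (rule locally_lipschitz_at2) (auto simp: locally_lipschitz_at_def intro: lipschitz_on_diff)

lemma locally_lipschitz_at_add:
  fixes f g :: "'a::metric_space \<Rightarrow> 'b::real_normed_vector"
  assumes "locally_lipschitz_at f p" "locally_lipschitz_at g p"
  shows "locally_lipschitz_at (\<lambda>x. f x + g x) p"
  using assms by (rule locally_lipschitz_at2) (auto simp: locally_lipschitz_at_def intro: lipschitz_on_add)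

text \<open>A Lipschitz function is bounded on a ball, here by \<open>a\<close> and
  \<open>b\<close>; the constant then comes from splitting the difference of products as in the
  product rule.\<close>

lemma locally_lipschitz_at_mult:
  fixes f g :: "'a::metric_space \<Rightarrow> 'b::real_normed_algebra"
  assumes "locally_lipschitz_at f p" "locally_lipschitz_at g p"
  shows "locally_lipschitz_at (\<lambda>x. f x * g x) p"
  using assms
proof (rule locally_lipschitz_at2)
  fix e L M
  assume e: "e > 0" and f: "L-lipschitz_on (ball p e) f" and g: "M-lipschitz_on (ball p e) g"
  have LM: "L \<ge> 0" "M \<ge> 0" using f g by (auto intro: lipschitz_on_nonneg)
  define a b where "a = norm (f p) + L * e" and "b = norm (g p) + M * e"
  have fb: "norm (f x) \<le> a" and gb: "norm (g x) \<le> b" if "x \<in> ball p e" for x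
  proof -
    have "dist (f x) (f p) \<le> L * dist x p" "dist (g x) (g p) \<le> M * dist x p"
      using that e f g by (auto intro: lipschitz_onD)
    moreover have "L * dist x p \<le> L * e" "M * dist x p \<le> M * e"
      using that LM by (auto intro!: mult_left_mono simp: dist_commute)
    moreover have "norm (f x) \<le> norm (f p) + dist (f x) (f p)" "norm (g x) \<le> norm (g p) + dist (g x) (g p)"
      by (simp_all add: dist_norm norm_triangle_sub)
    ultimately show "norm (f x) \<le> a" "norm (g x) \<le> b" unfolding a_def b_def by linarith+
  qed
  have ab: "a \<ge> 0" "b \<ge> 0" using LM e by (simp_all add: a_def b_def)
  have "(a * M + L * b)-lipschitz_on (ball p e) (\<lambda>x. f x * g x)"
  proof (rule lipschitz_onI)
    fix x y assume xy: "x \<in> ball p e" "y \<in> ball p e"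
    have "dist (f x * g x) (f y * g y) = norm (f x * (g x - g y) + (f x - f y) * g y)"
      by (simp add: dist_norm algebra_simps)
    also have "\<dots> \<le> norm (f x) * norm (g x - g y) + norm (f x - f y) * norm (g y)"
      by (intro order_trans[OF norm_triangle_ineq] add_mono norm_mult_ineq)
    also have "\<dots> \<le> a * (M * dist x y) + (L * dist x y) * b"
      using xy fb gb lipschitz_onD[OF f xy] lipschitz_onD[OF g xy] ab LM
      by (intro add_mono mult_mono) (auto simp: dist_norm)
    finally show "dist (f x * g x) (f y * g y) \<le> (a * M + L * b) * dist x y"
      by (simp add: algebra_simps)
  qed (use ab LM in auto)
  then show ?thesis using e unfolding locally_lipschitz_at_def by blast
qed

text \<open>The derivative of \<open>k\<close> is continuous, hence bounded on a closed disc around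
  \<open>f p\<close>, and the disc is convex. This rule covers \<open>h\<close>,
  \<open>deriv h\<close> and reciprocals.\<close>

lemma locally_lipschitz_at_holomorphic_comp:
  assumes f: "locally_lipschitz_at f p" and "open S" "k holomorphic_on S" "f p \<in> S"
  shows "locally_lipschitz_at (\<lambda>x. k (f x)) p"
proof -
  obtain d where d: "d > 0" "cball (f p) d \<subseteq> S" using assms(2,4) open_contains_cball by blast
  have "continuous_on (cball (f p) d) (deriv k)"
    using assms(2,3) d using continuous_on_subset[OF holomorphic_on_imp_continuous_on[OF holomorphic_deriv]] by blast
  then have "bounded (deriv k ` cball (f p) d)"
    by (intro compact_imp_bounded compact_continuous_image) auto
  then obtain K where K: "K > 0" "\<And>w. w \<in> cball (f p) d \<Longrightarrow> norm (deriv k w) \<le> K"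
    by (force simp: bounded_pos)
  have k: "K-lipschitz_on (cball (f p) d) k"
  proof (rule lipschitz_onI)
    fix x y assume "x \<in> cball (f p) d" "y \<in> cball (f p) d"
    moreover have "(k has_field_derivative deriv k w) (at w within cball (f p) d)"
      if "w \<in> cball (f p) d" for w
      using that d by (intro has_field_derivative_at_within[OF holomorphic_derivI[OF assms(3,2)]]) auto
    ultimately show "dist (k x) (k y) \<le> K * dist x y"
      unfolding dist_norm using K by (intro field_differentiable_bound[of "cball (f p) d" k "deriv k"]) auto
  qed (use K in simp)
  obtain e L where e: "e > 0" "L-lipschitz_on (ball p e) f"
    using f by (auto simp: locally_lipschitz_at_def)
  have L: "L \<ge> 0" using e(2) lipschitz_on_nonneg by blast
  \<comment> \<open>On this ball \<open>f\<close> stays within distance \<open>d\<close> of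
    \<open>f p\<close>; the added 1 keeps the divisor positive when \<open>L = 0\<close>.\<close>
  define e' where "e' = min e (d / (L + 1))"
  have e': "e' > 0" using e d L by (simp add: e'_def)
  have sub: "f ` ball p e' \<subseteq> cball (f p) d"
  proof clarify
    fix x assume x: "x \<in> ball p e'"
    then have "dist (f p) (f x) \<le> L * dist p x"
      using e by (auto intro!: lipschitz_onD simp: e'_def)
    also have "\<dots> \<le> (L + 1) * (d / (L + 1))"
      using x L by (intro mult_mono) (auto simp: e'_def)
    finally show "f x \<in> cball (f p) d" using L by simp
  qed
  have "(K * L)-lipschitz_on (ball p e') (\<lambda>x. k (f x))"
    by (rule lipschitz_on_compose2[where g=k and f=f])
       (use e(2) k sub in \<open>auto intro: lipschitz_on_subset simp: e'_def\<close>)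
  then show ?thesis using e' by (auto simp: locally_lipschitz_at_def)
qed

lemma locally_lipschitz_at_inverse:
  fixes f :: "'a::metric_space \<Rightarrow> complex"
  assumes "locally_lipschitz_at f p" "f p \<noteq> 0"
  shows "locally_lipschitz_at (\<lambda>x. inverse (f x)) p"
  by (rule locally_lipschitz_at_holomorphic_comp[OF assms(1), of "- {0}"])
     (use assms(2) in \<open>auto intro!: holomorphic_intros\<close>)

lemma locally_lipschitz_at_vec:
  fixes F :: "'a::metric_space \<Rightarrow> 'b::real_normed_vector ^ 'n"
  assumes "\<And>i. locally_lipschitz_at (\<lambda>x. F x $ i) p"
  shows "locally_lipschitz_at F p"
proof -
  obtain e L where eL: "\<And>i. e i > 0" "\<And>i. (L i)-lipschitz_on (ball p (e i)) (\<lambda>x. F x $ i)"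
    using assms unfolding locally_lipschitz_at_def by metis
  define d where "d = Min (range e)"
  have d: "d > 0" "\<And>i. d \<le> e i" using eL(1) by (auto simp: d_def)
  have "(\<Sum>i\<in>UNIV. L i)-lipschitz_on (ball p d) F"
  proof (rule lipschitz_onI)
    fix x y assume xy: "x \<in> ball p d" "y \<in> ball p d"
    have "dist (F x) (F y) \<le> (\<Sum>i\<in>UNIV. norm ((F x - F y) $ i))"
      unfolding dist_norm norm_vec_def by (rule L2_set_le_sum) simp
    also have "\<dots> \<le> (\<Sum>i\<in>UNIV. L i * dist x y)"
    proof (rule sum_mono)
      fix i show "norm ((F x - F y) $ i) \<le> L i * dist x y"
        using lipschitz_onD[OF eL(2)[of i], of x y] xy d(2)[of i] by (auto simp: dist_norm)
    qed
    finally show "dist (F x) (F y) \<le> (\<Sum>i\<in>UNIV. L i) * dist x y" by (simp add: sum_distrib_right)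
  qed (intro sum_nonneg lipschitz_on_nonneg[OF eL(2)])
  then show ?thesis using d by (auto simp: locally_lipschitz_at_def)
qed

section \<open>Uniqueness in real time, existence in complex time\<close>

lemma ode_unique:
  fixes y1 y2 :: "real \<Rightarrow> 'a::real_normed_vector"
  assumes J: "open J" "connected J" "t0 \<in> J" and init: "y1 t0 = y2 t0"
    and y1: "\<And>t. t \<in> J \<Longrightarrow> (y1 has_vector_derivative F (y1 t)) (at t)"
    and y2: "\<And>t. t \<in> J \<Longrightarrow> (y2 has_vector_derivative F (y2 t)) (at t)"
    and lip: "\<And>t. t \<in> J \<Longrightarrow> locally_lipschitz_at F (y1 t)"
    and "t \<in> J"
  shows "y1 t = y2 t"
proof -
  have cont1: "continuous_on J y1" and cont2: "continuous_on J y2"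
    using has_vector_derivative_continuous[OF y1] has_vector_derivative_continuous[OF y2]
    by (auto intro!: continuous_at_imp_continuous_on)
  define D where "D = (\<lambda>t. y1 t - y2 t)"
  have contD: "continuous_on J D" unfolding D_def by (intro continuous_intros cont1 cont2)
  \<comment> \<open>The set of agreement is open: on a small ball the norm of \<open>D\<close>
    attains its maximum, and the mean value inequality bounds this maximum by half of
    itself.\<close>
  have local: "\<exists>\<delta>>0. \<forall>u\<in>cball s \<delta>. D u = 0" if s: "s \<in> J" "D s = 0" for s
  proof -
    obtain e L where e: "e > 0" "L-lipschitz_on (ball (y1 s) e) F"
      using lip[OF s(1)] by (auto simp: locally_lipschitz_at_def)
    have L: "L \<ge> 0" using e(2) lipschitz_on_nonneg by blast
    have ys: "y1 s = y2 s" using s by (simp add: D_def)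
    \<comment> \<open>The Lipschitz ball around \<open>y1 s\<close> also catches \<open>y2\<close>
      near \<open>s\<close>, because the two solutions agree at \<open>s\<close>.\<close>
    have "open (J \<inter> y1 -` ball (y1 s) e)" "open (J \<inter> y2 -` ball (y1 s) e)"
      using J(1) cont1 cont2 by (auto intro: continuous_open_preimage)
    then have "open ((J \<inter> y1 -` ball (y1 s) e) \<inter> (J \<inter> y2 -` ball (y1 s) e))" by blast
    moreover have "s \<in> (J \<inter> y1 -` ball (y1 s) e) \<inter> (J \<inter> y2 -` ball (y1 s) e)"
      using s e ys by auto
    ultimately obtain d where d: "d > 0"
      "cball s d \<subseteq> (J \<inter> y1 -` ball (y1 s) e) \<inter> (J \<inter> y2 -` ball (y1 s) e)"
      using open_contains_cball by blast
    define \<delta> where "\<delta> = min d (1 / (2 * (L + 1)))"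
    have \<delta>: "\<delta> > 0" "\<delta> \<le> d" "L * \<delta> \<le> 1 / 2"
    proof -
      have "L * \<delta> \<le> (L + 1) * (1 / (2 * (L + 1)))"
        using L d by (intro mult_mono) (auto simp: \<delta>_def)
      also have "\<dots> = 1 / 2" using L by (simp add: field_simps)
      finally show "L * \<delta> \<le> 1 / 2" .
    qed (use d L in \<open>auto simp: \<delta>_def\<close>)
    have sub: "cball s \<delta> \<subseteq> J" using d \<delta> by auto
    have "continuous_on (cball s \<delta>) (\<lambda>u. norm (D u))"
      using contD sub by (intro continuous_intros) (rule continuous_on_subset)
    then obtain m where m: "m \<in> cball s \<delta>" "\<And>u. u \<in> cball s \<delta> \<Longrightarrow> norm (D u) \<le> norm (D m)"
      using continuous_attains_sup[of "cball s \<delta>" "\<lambda>u. norm (D u)"] \<delta> by auto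
    have "norm (D m - D s) \<le> (L * norm (D m)) * norm (m - s)"
    proof (rule differentiable_bound[of "cball s \<delta>" D "\<lambda>u x. x *\<^sub>R (F (y1 u) - F (y2 u))"])
      fix u assume u: "u \<in> cball s \<delta>"
      then have "u \<in> J" using sub by auto
      then have "(D has_vector_derivative F (y1 u) - F (y2 u)) (at u within cball s \<delta>)"
        unfolding D_def
        by (intro has_vector_derivative_diff has_vector_derivative_at_within[OF y1]
              has_vector_derivative_at_within[OF y2])
      then show "(D has_derivative (\<lambda>x. x *\<^sub>R (F (y1 u) - F (y2 u)))) (at u within cball s \<delta>)"
        by (simp add: has_vector_derivative_def)
      have "norm (F (y1 u) - F (y2 u)) \<le> L * norm (D u)"
      proof -
        have "u \<in> cball s d" using u \<delta> by auto
        then have "y1 u \<in> ball (y1 s) e" "y2 u \<in> ball (y1 s) e" using d(2) by blast+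
        then show ?thesis using lipschitz_onD[OF e(2)] by (simp add: dist_norm D_def)
      qed
      also have "\<dots> \<le> L * norm (D m)" using m u L by (intro mult_left_mono) auto
      finally have "norm (F (y1 u) - F (y2 u)) \<le> L * norm (D m)" .
      then show "onorm (\<lambda>x. x *\<^sub>R (F (y1 u) - F (y2 u))) \<le> L * norm (D m)"
        by (simp add: onorm_scaleR_left[OF bounded_linear_ident] onorm_id)
    qed (use m \<delta> in auto)
    also have "\<dots> \<le> (L * norm (D m)) * \<delta>"
      using m L by (intro mult_left_mono) (auto simp: dist_norm norm_minus_commute)
    also have "\<dots> = (L * \<delta>) * norm (D m)" by simp
    also have "\<dots> \<le> (1 / 2) * norm (D m)" using \<delta> by (intro mult_right_mono) auto
    finally have "norm (D m) = 0" using s by simp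
    then have "\<forall>u\<in>cball s \<delta>. D u = 0" using m(2) by force
    then show ?thesis using \<delta> by blast
  qed
  \<comment> \<open>The zero set of \<open>D\<close> is open and closed in the connected set
    \<open>J\<close>.\<close>
  have "J \<inter> D -` {0} = {} \<or> J \<inter> D -` {0} = J"
  proof -
    have "openin (top_of_set J) (J \<inter> D -` {0})"
      unfolding openin_contains_cball
    proof (intro conjI ballI)
      fix s assume "s \<in> J \<inter> D -` {0}"
      with local[of s] show "\<exists>e>0. cball s e \<inter> J \<subseteq> J \<inter> D -` {0}" by fastforce
    qed auto
    moreover have "closedin (top_of_set J) (J \<inter> D -` {0})"
      using contD by (auto intro: continuous_closedin_preimage)
    ultimately show ?thesis using J(2) unfolding connected_clopen by blast
  qed
  moreover have "t0 \<in> J \<inter> D -` {0}" using J init by (auto simp: D_def)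
  ultimately show ?thesis using \<open>t \<in> J\<close> by (auto simp: D_def)
qed


text \<open>The mean value inequality is used in each component; the factor \<open>CARD('n)\<close>
  is the price of bounding the norm by the sum over components, and reappears as \<open>N\<close> in
  the choice of the radius below.\<close>

lemma has_field_derivative_vec_bound:
  fixes f f' :: "complex \<Rightarrow> complex ^ 'n::finite"
  assumes "convex S" "a \<in> S" "t \<in> S"
    and f: "\<And>i s. s \<in> S \<Longrightarrow> ((\<lambda>s. f s $ i) has_field_derivative f' s $ i) (at s)"
    and B: "\<And>s. s \<in> S \<Longrightarrow> norm (f' s) \<le> B"
  shows "norm (f t - f a) \<le> CARD('n) * (B * norm (t - a))"
proof -
  have "norm (f t - f a) \<le> (\<Sum>i\<in>UNIV. norm ((f t - f a) $ i))"
    unfolding norm_vec_def by (rule L2_set_le_sum) simp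
  also have "\<dots> \<le> (\<Sum>i\<in>(UNIV::'n set). B * norm (t - a))"
  proof (rule sum_mono)
    fix i
    have "norm (f t $ i - f a $ i) \<le> B * norm (t - a)"
    proof (rule field_differentiable_bound[OF \<open>convex S\<close>])
      show "((\<lambda>s. f s $ i) has_field_derivative f' s $ i) (at s within S)" if "s \<in> S" for s
        using f[OF that] by (rule has_field_derivative_at_within)
      show "norm (f' s $ i) \<le> B" if "s \<in> S" for s
        using B[OF that] Finite_Cartesian_Product.norm_nth_le[of "f' s" i] by linarith
    qed (use assms in auto)
    then show "norm ((f t - f a) $ i) \<le> B * norm (t - a)" by simp
  qed
  finally show ?thesis by simp
qed

text \<open>Picard iteration, in which each iterate is a primitive on the disc instead of an integral.\<close>

lemma holomorphic_ode_exists: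
  fixes F :: "complex ^ 'n::finite \<Rightarrow> complex ^ 'n"
  assumes G: "open G" "y0 \<in> G" and lip: "locally_lipschitz_at F y0"
    and hol: "\<And>A y i. open A \<Longrightarrow> (\<And>j. (\<lambda>t. y t $ j) holomorphic_on A) \<Longrightarrow> y ` A \<subseteq> G \<Longrightarrow>
                (\<lambda>t. F (y t) $ i) holomorphic_on A"
  obtains r y where "r > 0" "y 0 = y0" "\<And>t. t \<in> ball 0 r \<Longrightarrow> y t \<in> G"
    "\<And>t i. t \<in> ball 0 r \<Longrightarrow> ((\<lambda>s. y s $ i) has_field_derivative F (y t) $ i) (at t)"
proof -
  obtain e0 L where e0: "e0 > 0" "L-lipschitz_on (ball y0 e0) F"
    using lip by (auto simp: locally_lipschitz_at_def)
  obtain e1 where e1: "e1 > 0" "cball y0 e1 \<subseteq> G" using G open_contains_cball by blast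
  \<comment> \<open>Halving \<open>e0\<close> lets the closed ball of radius \<open>e\<close> fit
    into the open ball on which \<open>F\<close> is Lipschitz.\<close>
  define e where "e = min (e0 / 2) e1"
  have e: "e > 0" "cball y0 e \<subseteq> G" using e0 e1 by (auto simp: e_def)
  have FL: "L-lipschitz_on (cball y0 e) F"
    using e0 by (auto intro!: lipschitz_on_subset[OF e0(2)] simp: e_def)
  have L: "L \<ge> 0" using FL lipschitz_on_nonneg by blast
  define M where "M = norm (F y0) + L * e"
  have M: "norm (F p) \<le> M" if "p \<in> cball y0 e" for p
  proof -
    have "norm (F p) \<le> norm (F y0) + dist (F p) (F y0)" by (simp add: dist_norm norm_triangle_sub)
    also have "dist (F p) (F y0) \<le> L * dist p y0" using that e by (intro lipschitz_onD[OF FL]) auto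
    also have "\<dots> \<le> L * e" using that L by (intro mult_left_mono) (auto simp: dist_commute)
    finally show ?thesis by (simp add: M_def)
  qed
  have M0: "M \<ge> 0" using L e by (simp add: M_def)
  define N where "N = real CARD('n)"
  have N: "N > 0" by (simp add: N_def)
  \<comment> \<open>The first bound keeps all iterates in \<open>cball y0 e\<close>, the second
    makes each Picard step halve distances. The added 1 guards against \<open>M = 0\<close> and
    \<open>L = 0\<close>.\<close>
  define r where "r = min (e / (N * (M + 1))) (1 / (2 * N * (L + 1)))"
  have r: "r > 0" using e N M0 L by (simp add: r_def)
  have rM: "N * (M * r) \<le> e"
  proof -
    have "N * (M * r) \<le> N * ((M + 1) * (e / (N * (M + 1))))"
      using N M0 r by (intro mult_left_mono mult_mono) (auto simp: r_def)
    also have "\<dots> = (N * (M + 1)) * e / (N * (M + 1))" by simp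
    also have "\<dots> = e" using N M0 by (intro nonzero_mult_div_cancel_left) auto
    finally show ?thesis .
  qed
  have rL: "N * (L * r) \<le> 1 / 2"
  proof -
    have "N * (L * r) \<le> N * ((L + 1) * (1 / (2 * N * (L + 1))))"
      using N L r by (intro mult_left_mono mult_mono) (auto simp: r_def)
    also have "\<dots> = (N * (L + 1)) * 1 / (N * (L + 1)) / 2" by simp
    also have "(N * (L + 1)) * 1 / (N * (L + 1)) = 1"
      using N L by (intro nonzero_mult_div_cancel_left) auto
    finally show ?thesis .
  qed
  define good where "good y \<longleftrightarrow> (\<forall>j. (\<lambda>t. y t $ j) holomorphic_on ball 0 r) \<and> y ` ball 0 r \<subseteq> cball y0 e"
    for y :: "complex \<Rightarrow> complex ^ 'n"
  \<comment> \<open>A relation rather than a function: the next iterate is obtained by choosing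
    primitives, so the sequence is built by dependent choice.\<close>
  define step where "step y y' \<longleftrightarrow> y' 0 = y0 \<and>
    (\<forall>t\<in>ball 0 r. \<forall>i. ((\<lambda>s. y' s $ i) has_field_derivative F (y t) $ i) (at t))"
    for y y' :: "complex \<Rightarrow> complex ^ 'n"
  have step_ex: "\<exists>y'. good y' \<and> step y y'" if y: "good y" for y
  proof -
    have "\<exists>g. \<forall>t\<in>ball 0 r. (g has_field_derivative F (y t) $ i) (at t)" for i
    proof -
      \<comment> \<open>Holomorphy of \<open>F\<close> is only ever used along holomorphic curves,
        which is the form of the assumption \<open>hol\<close>.\<close>
      have "(\<lambda>t. F (y t) $ i) holomorphic_on ball 0 r"
        by (rule hol) (use y e in \<open>auto simp: good_def\<close>)
      then obtain g where "\<And>t. t \<in> ball 0 r \<Longrightarrow> (g has_field_derivative F (y t) $ i) (at t within ball 0 r)"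
        using holomorphic_convex_primitive'[OF convex_ball open_ball] by metis
      then show ?thesis by (intro exI[of _ g]) (auto simp: at_within_open[of _ "ball 0 r"])
    qed
    then obtain g where g: "\<And>i t. t \<in> ball 0 r \<Longrightarrow> (g i has_field_derivative F (y t) $ i) (at t)"
      by metis
    define y' where "y' = (\<lambda>t. y0 + (\<chi> i. g i t - g i 0))"
    have d: "((\<lambda>s. y' s $ i) has_field_derivative F (y t) $ i) (at t)" if "t \<in> ball 0 r" for t i
      unfolding y'_def using g[OF that, of i] by (auto intro!: derivative_eq_intros)
    have "norm (y' t - y' 0) \<le> N * (M * norm (t - 0))" if "t \<in> ball 0 r" for t
      unfolding N_def
    proof (rule has_field_derivative_vec_bound[where f'="\<lambda>t. F (y t)", OF convex_ball _ that])
      show "norm (F (y s)) \<le> M" if "s \<in> ball 0 r" for s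
        using that y M[of "y s"] by (force simp: good_def image_subset_iff)
    qed (use r d in auto)
    moreover have "N * (M * norm (t - 0)) \<le> N * (M * r)" if "t \<in> ball 0 r" for t :: complex
      using that N M0 by (intro mult_left_mono) auto
    moreover have y'0: "y' 0 = y0" by (simp add: y'_def vec_eq_iff)
    ultimately have "y' ` ball 0 r \<subseteq> cball y0 e"
      using rM by (force simp: dist_norm norm_minus_commute)
    moreover have "(\<lambda>t. y' t $ j) holomorphic_on ball 0 r" for j
      using d holomorphic_on_open[OF open_ball] by blast
    ultimately show ?thesis using d y'0 unfolding good_def step_def by blast
  qed
  have "\<exists>Y. \<forall>n. (good (Y n) \<and> (n = 0 \<longrightarrow> Y n = (\<lambda>_. y0))) \<and> step (Y n) (Y (Suc n))"
    by (rule dependent_nat_choice) (use step_ex e in \<open>auto simp: good_def\<close>)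
  then obtain Y where good: "\<And>n. good (Y n)" and Y0: "Y 0 = (\<lambda>_. y0)" and step: "\<And>n. step (Y n) (Y (Suc n))"
    by auto
  have mem: "Y n t \<in> cball y0 e" if "t \<in> ball 0 r" for n t
    using good[of n] that by (force simp: good_def image_subset_iff)
  have diff: "norm (Y (Suc n) t - Y n t) \<le> e * (1 / 2) ^ n" if "t \<in> ball 0 r" for n t
    using that
  proof (induction n arbitrary: t)
    case 0
    then show ?case using mem[OF 0, of 1] Y0 by (simp add: dist_norm norm_minus_commute)
  next
    case (Suc n)
    have "norm ((Y (Suc (Suc n)) t - Y (Suc n) t) - (Y (Suc (Suc n)) 0 - Y (Suc n) 0))
        \<le> N * ((L * (e * (1 / 2) ^ n)) * norm (t - 0))"
      unfolding N_def
    proof (rule has_field_derivative_vec_bound[where S="ball 0 r" and f'="\<lambda>t. F (Y (Suc n) t) - F (Y n t)"])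
      fix i s assume s: "s \<in> ball (0::complex) r"
      show "((\<lambda>s. (Y (Suc (Suc n)) s - Y (Suc n) s) $ i) has_field_derivative (F (Y (Suc n) s) - F (Y n s)) $ i) (at s)"
        using step[of "Suc n"] step[of n] s by (auto simp: step_def intro!: derivative_intros)
    next
      fix s assume s: "s \<in> ball (0::complex) r"
      have "norm (F (Y (Suc n) s) - F (Y n s)) \<le> L * norm (Y (Suc n) s - Y n s)"
        using lipschitz_onD[OF FL mem[OF s] mem[OF s]] by (simp add: dist_norm)
      also have "\<dots> \<le> L * (e * (1 / 2) ^ n)" using Suc.IH[OF s] L by (intro mult_left_mono)
      finally show "norm (F (Y (Suc n) s) - F (Y n s)) \<le> L * (e * (1 / 2) ^ n)" .
    qed (use r Suc.prems in auto)
    also have "\<dots> \<le> N * ((L * (e * (1 / 2) ^ n)) * r)"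
      using Suc.prems N L e by (intro mult_left_mono) auto
    also have "\<dots> = (N * (L * r)) * (e * (1 / 2) ^ n)" by (simp add: algebra_simps)
    also have "\<dots> \<le> (1 / 2) * (e * (1 / 2) ^ n)" using rL e by (intro mult_right_mono) auto
    finally show ?case using step[of "Suc n"] step[of n] by (simp add: step_def)
  qed
  \<comment> \<open>Writing the limit as a telescoping series lets the geometric bound
    \<open>diff\<close> give uniform convergence by the Weierstrass test.\<close>
  define y where "y t = y0 + (\<Sum>n. Y (Suc n) t - Y n t)" for t
  have tele: "(\<Sum>k<n. Y (Suc k) t - Y k t) = Y n t - y0" for n t
    using sum_lessThan_telescope[of "\<lambda>k. Y k t" n] by (simp add: Y0)
  have "uniform_limit (ball 0 r) (\<lambda>n t. \<Sum>k<n. Y (Suc k) t - Y k t) (\<lambda>t. \<Sum>n. Y (Suc n) t - Y n t) sequentially"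
    by (rule Weierstrass_m_test[where M="\<lambda>n. e * (1 / 2) ^ n"])
       (use diff in \<open>auto intro!: summable_mult summable_geometric\<close>)
  then have "uniform_limit (ball 0 r) (\<lambda>n t. y0 + (Y n t - y0)) y sequentially"
    unfolding tele y_def by (intro uniform_limit_intros)
  then have ulim: "uniform_limit (ball 0 r) Y y sequentially" by simp
  have lim: "(\<lambda>n. Y n t) \<longlonglongrightarrow> y t" if "t \<in> ball 0 r" for t
    using tendsto_uniform_limitI[OF ulim that] .
  have ymem: "y t \<in> cball y0 e" if "t \<in> ball 0 r" for t
    by (rule closed_sequentially[OF closed_cball _ lim[OF that]]) (rule mem[OF that])
  have Y0': "Y n 0 = y0" for n using step[of "n - 1"] Y0 by (cases n) (auto simp: step_def)
  have y_init: "y 0 = y0" using lim[of 0] r LIMSEQ_unique[OF _ tendsto_const] by (auto simp: Y0')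
  have deriv: "((\<lambda>s. y s $ i) has_field_derivative F (y t) $ i) (at t)" if t: "t \<in> ball 0 r" for t i
  proof -
    \<comment> \<open>The shift to \<open>Suc n\<close> is needed because \<open>Y (Suc n)\<close>
      has derivative \<open>F (Y n)\<close>. These derivatives converge uniformly to
      \<open>F y\<close> by the Lipschitz bound, so differentiation passes to the limit.\<close>
    have "\<exists>g. \<forall>x\<in>ball 0 r. (\<lambda>n. Y (Suc n) x $ i) \<longlonglongrightarrow> g x \<and>
       (g has_field_derivative F (y x) $ i) (at x within ball 0 r)"
    proof (rule has_complex_derivative_sequence)
      show "((\<lambda>x. Y (Suc n) x $ i) has_field_derivative F (Y n x) $ i) (at x within ball 0 r)"
        if "x \<in> ball 0 r" for n x
        using step[of n] that by (auto simp: step_def intro: has_field_derivative_at_within)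
      fix \<epsilon> :: real assume "\<epsilon> > 0"
      then have "\<epsilon> / (L + 1) > 0" using L by simp
      with ulim obtain n0 where n0: "\<And>n x. n \<ge> n0 \<Longrightarrow> x \<in> ball 0 r \<Longrightarrow> dist (Y n x) (y x) < \<epsilon> / (L + 1)"
        unfolding uniform_limit_iff eventually_sequentially by meson
      have "norm (F (Y n x) $ i - F (y x) $ i) \<le> \<epsilon>" if "n \<ge> n0" "x \<in> ball 0 r" for n x
      proof -
        have "norm (F (Y n x) $ i - F (y x) $ i) \<le> dist (F (Y n x)) (F (y x))"
          unfolding dist_norm using Finite_Cartesian_Product.norm_nth_le[of "F (Y n x) - F (y x)" i] by simp
        also have "\<dots> \<le> L * dist (Y n x) (y x)"
          by (rule lipschitz_onD[OF FL mem[OF that(2)] ymem[OF that(2)]])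
        also have "\<dots> \<le> (L + 1) * (\<epsilon> / (L + 1))"
          using n0[OF that] L by (intro mult_mono) auto
        also have "\<dots> = \<epsilon>" using L by simp
        finally show ?thesis .
      qed
      then show "\<exists>N. \<forall>n x. N \<le> n \<longrightarrow> x \<in> ball 0 r \<longrightarrow> norm (F (Y n x) $ i - F (y x) $ i) \<le> \<epsilon>"
        by blast
    next
      show "\<exists>x l. x \<in> ball 0 r \<and> (\<lambda>n. Y (Suc n) x $ i) \<longlonglongrightarrow> l"
        using r by (intro exI[of _ 0] exI[of _ "y0 $ i"]) (simp add: Y0')
    qed auto
    then obtain g where g: "\<And>x. x \<in> ball 0 r \<Longrightarrow> (\<lambda>n. Y (Suc n) x $ i) \<longlonglongrightarrow> g x"
      "\<And>x. x \<in> ball 0 r \<Longrightarrow> (g has_field_derivative F (y x) $ i) (at x within ball 0 r)"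
      by blast
    have "g x = y x $ i" if "x \<in> ball 0 r" for x
    proof (rule LIMSEQ_unique[OF g(1)[OF that]])
      show "(\<lambda>n. Y (Suc n) x $ i) \<longlonglongrightarrow> y x $ i"
        using lim[OF that] by (intro tendsto_vec_nth) (rule LIMSEQ_Suc)
    qed
    then show ?thesis
      using has_field_derivative_transform_within_open[OF _ open_ball t, of g "F (y t) $ i" "\<lambda>s. y s $ i"]
        g(2)[OF t] t by (simp add: at_within_open[of _ "ball 0 r"])
  qed
  show thesis by (rule that[of r y, OF r y_init]) (use ymem e deriv in auto)
qed

section \<open>Real and complex geodesics\<close>

lemma has_vector_derivative_Complex_iff:
  "((\<lambda>t. Complex (f t) (g t)) has_vector_derivative d) (at t) \<longleftrightarrow>
     (f has_field_derivative Re d) (at t) \<and> (g has_field_derivative Im d) (at t)"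
proof
  assume "((\<lambda>t. Complex (f t) (g t)) has_vector_derivative d) (at t)"
  then show "(f has_field_derivative Re d) (at t) \<and> (g has_field_derivative Im d) (at t)"
    using has_field_derivative_Re has_field_derivative_Im by fastforce
next
  assume "(f has_field_derivative Re d) (at t) \<and> (g has_field_derivative Im d) (at t)"
  then have "(f has_vector_derivative Re d) (at t)" "(g has_vector_derivative Im d) (at t)"
    by (simp_all add: has_real_derivative_iff_has_vector_derivative)
  then have "((\<lambda>t. of_real (f t) + \<i> * of_real (g t)) has_vector_derivative of_real (Re d) + \<i> * of_real (Im d)) (at t)"
    by (intro has_vector_derivative_add bounded_linear.has_vector_derivative[OF bounded_linear_of_real]
          bounded_linear.has_vector_derivative[OF bounded_linear_compose[OF bounded_linear_mult_right bounded_linear_of_real]])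
  then show "((\<lambda>t. Complex (f t) (g t)) has_vector_derivative d) (at t)"
    by (simp add: complex_eq flip: Complex_eq)
qed

lemma has_vector_derivative_vecI:
  fixes f :: "real \<Rightarrow> 'a::real_normed_vector ^ 'n::finite"
  assumes "\<And>i. ((\<lambda>t. f t $ i) has_vector_derivative D $ i) (at t)"
  shows "(f has_vector_derivative D) (at t)"
  using assms unfolding has_vector_derivative_def has_derivative_def
  by (auto intro!: vec_tendstoI bounded_linear_scaleR_left)

text \<open>Phase space over the chart: components 1 and 2 are the position, 3 and 4 the velocity,
  which is unconstrained.\<close>

definition geodesic_state :: "(complex \<Rightarrow> complex) \<Rightarrow> complex set \<Rightarrow> (complex ^ 4) set" where
  "geodesic_state h U = {q. q $ 1 \<in> U \<and> q $ 2 \<noteq> 0 \<and> h (q $ 1) - (q $ 2)\<^sup>2 \<noteq> 0}"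

text \<open>The geodesic equations as a first order system. The same field is followed in complex
  time by geodesics of \<open>G_C\<close> and in real time by geodesics of
  \<open>g_KN\<close>.\<close>

definition geodesic_field :: "(complex \<Rightarrow> complex) \<Rightarrow> complex ^ 4 \<Rightarrow> complex ^ 4" where
  "geodesic_field h q = vector [q $ 3, q $ 4,
     accel_z h (q $ 1) (q $ 2) (q $ 3) (q $ 4), accel_X h (q $ 1) (q $ 2) (q $ 3) (q $ 4)]"

lemma geodesic_on_G_C_iff:
  assumes "open U" "h holomorphic_on U"
  shows "geodesic_on (G_C h) (H_C U h) S (\<lambda>\<upsilon>. c_point (Z \<upsilon>) (\<XX> \<upsilon>)) \<longleftrightarrow>
    (\<exists>v w. \<forall>t\<in>S. vector [Z t, \<XX> t, v t, w t] \<in> geodesic_state h U \<and>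
      (\<forall>i. ((\<lambda>s. vector [Z s, \<XX> s, v s, w s] $ i) has_field_derivative
             geodesic_field h (vector [Z t, \<XX> t, v t, w t]) $ i) (at t)))"
    (is "?L \<longleftrightarrow> ?R")
proof -
  have H: "c_point z X \<in> H_C U h \<longleftrightarrow> vector [z, X, v, w] \<in> geodesic_state h U" for z X v w
    by (auto simp: H_C_def c_point_def geodesic_state_def)
  note chr = christoffel_G_C[OF assms, of "c_point z X" for z X, unfolded c_point_def vector_2, folded c_point_def]
  show ?thesis
  proof
    assume ?L
    then obtain v a where mem: "\<And>t. t \<in> S \<Longrightarrow> c_point (Z t) (\<XX> t) \<in> H_C U h"
      and c: "\<And>t i. t \<in> S \<Longrightarrow> ((\<lambda>s. c_point (Z s) (\<XX> s) $ i) has_field_derivative v t $ i) (at t)"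
      and d: "\<And>t i. t \<in> S \<Longrightarrow> ((\<lambda>s. v s $ i) has_field_derivative a t $ i) (at t)"
      and e: "\<And>t i. t \<in> S \<Longrightarrow> a t $ i + (\<Sum>j\<in>UNIV. \<Sum>k\<in>UNIV.
         christoffel (G_C h) (c_point (Z t) (\<XX> t)) i j k * v t $ j * v t $ k) = 0"
      unfolding geodesic_on_def by blast
    have "a t $ 1 = accel_z h (Z t) (\<XX> t) (v t $ 1) (v t $ 2)"
      "a t $ 2 = accel_X h (Z t) (\<XX> t) (v t $ 1) (v t $ 2)" if "t \<in> S" for t
      using e[OF that, of 1] e[OF that, of 2] chr[OF mem[OF that]] by simp_all
    then show ?R
      using mem c[where i=1] c[where i=2] d[where i=1] d[where i=2] H
      by (intro exI[of _ "\<lambda>t. v t $ 1"] exI[of _ "\<lambda>t. v t $ 2"])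
         (simp add: forall_4 geodesic_field_def c_point_def)
  next
    assume ?R
    then obtain v w where *: "\<forall>t\<in>S. vector [Z t, \<XX> t, v t, w t] \<in> geodesic_state h U \<and>
      (\<forall>i. ((\<lambda>s. vector [Z s, \<XX> s, v s, w s] $ i) has_field_derivative
             geodesic_field h (vector [Z t, \<XX> t, v t, w t]) $ i) (at t))" by blast
    then have mem: "\<And>t. t \<in> S \<Longrightarrow> c_point (Z t) (\<XX> t) \<in> H_C U h" using H by blast
    have d: "\<And>t. t \<in> S \<Longrightarrow> (Z has_field_derivative v t) (at t)"
        "\<And>t. t \<in> S \<Longrightarrow> (\<XX> has_field_derivative w t) (at t)"
        "\<And>t. t \<in> S \<Longrightarrow> (v has_field_derivative accel_z h (Z t) (\<XX> t) (v t) (w t)) (at t)"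
        "\<And>t. t \<in> S \<Longrightarrow> (w has_field_derivative accel_X h (Z t) (\<XX> t) (v t) (w t)) (at t)"
      using * by (auto simp: forall_4 geodesic_field_def)
    show ?L unfolding geodesic_on_def
      using mem d chr[OF mem, where v="c_point _ _"]
      by (intro conjI exI[of _ "\<lambda>t. c_point (v t) (w t)"]
            exI[of _ "\<lambda>t. c_point (accel_z h (Z t) (\<XX> t) (v t) (w t)) (accel_X h (Z t) (\<XX> t) (v t) (w t))"])
         (simp_all add: forall_2 c_point_def)
  qed
qed

text \<open>The right-hand side is that of \<open>geodesic_on_G_C_iff\<close> with
  \<open>has_vector_derivative\<close> in place of \<open>has_field_derivative\<close>: here the
  real connection gives way to the holomorphic one, and only the kind of time distinguishes the two
  geometries.\<close>

lemma geodesic_on_g_KN_iff: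
  assumes "open U" "h holomorphic_on U"
  shows "geodesic_on (g_KN h) (H_KN U h) S (\<lambda>s. kn_point (x s) (\<phi> s) (y s) (\<psi> s)) \<longleftrightarrow>
    (\<exists>v w. \<forall>t\<in>S. vector [Complex (x t) (y t), Complex (\<phi> t) (\<psi> t), v t, w t] \<in> geodesic_state h U \<and>
      (\<forall>i. ((\<lambda>s. vector [Complex (x s) (y s), Complex (\<phi> s) (\<psi> s), v s, w s] $ i) has_vector_derivative
             geodesic_field h (vector [Complex (x t) (y t), Complex (\<phi> t) (\<psi> t), v t, w t]) $ i) (at t)))"
    (is "?L \<longleftrightarrow> ?R")
proof -
  define c where "c s = kn_point (x s) (\<phi> s) (y s) (\<psi> s)" for s
  have [simp]: "c s $ 1 = x s" "c s $ 2 = \<phi> s" "c s $ 3 = y s" "c s $ 4 = \<psi> s" for s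
    by (simp_all add: c_def kn_point_def)
  have H: "c s \<in> H_KN U h \<longleftrightarrow> vector [Complex (x s) (y s), Complex (\<phi> s) (\<psi> s), v, w] \<in> geodesic_state h U" for s v w
    by (auto simp: H_KN_def geodesic_state_def simp del: Complex_eq_0)
  note chr = christoffel_g_KN[OF assms, of "c s" for s, simplified]
  show ?thesis
  proof
    assume ?L
    then obtain v a where mem: "\<And>t. t \<in> S \<Longrightarrow> c t \<in> H_KN U h"
      and d1: "\<And>t i. t \<in> S \<Longrightarrow> ((\<lambda>s. c s $ i) has_field_derivative v t $ i) (at t)"
      and d2: "\<And>t i. t \<in> S \<Longrightarrow> ((\<lambda>s. v s $ i) has_field_derivative a t $ i) (at t)"
      and e: "\<And>t i. t \<in> S \<Longrightarrow> a t $ i + (\<Sum>j\<in>UNIV. \<Sum>k\<in>UNIV.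
         christoffel (g_KN h) (c t) i j k * v t $ j * v t $ k) = 0"
      unfolding geodesic_on_def c_def[symmetric] by blast
    have "accel_z h (Complex (x t) (y t)) (Complex (\<phi> t) (\<psi> t)) (kn_z (v t)) (kn_X (v t)) = kn_z (a t)"
      "accel_X h (Complex (x t) (y t)) (Complex (\<phi> t) (\<psi> t)) (kn_z (v t)) (kn_X (v t)) = kn_X (a t)"
      if "t \<in> S" for t
      using e[OF that, of 1] e[OF that, of 2] e[OF that, of 3] e[OF that, of 4]
        chr[OF mem[OF that], of "v t"] by (simp_all add: complex_eq_iff)
    then show ?R
      using mem d1[where i=1] d1[where i=2] d2[where i=1] d2[where i=2]
        d1[where i=3] d1[where i=4] d2[where i=3] d2[where i=4] H
      by (intro exI[of _ "\<lambda>t. kn_z (v t)"] exI[of _ "\<lambda>t. kn_X (v t)"])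
         (simp add: forall_4 geodesic_field_def has_vector_derivative_Complex_iff)
  next
    assume ?R
    then obtain v w where *: "\<forall>t\<in>S. vector [Complex (x t) (y t), Complex (\<phi> t) (\<psi> t), v t, w t] \<in> geodesic_state h U \<and>
      (\<forall>i. ((\<lambda>s. vector [Complex (x s) (y s), Complex (\<phi> s) (\<psi> s), v s, w s] $ i) has_vector_derivative
             geodesic_field h (vector [Complex (x t) (y t), Complex (\<phi> t) (\<psi> t), v t, w t]) $ i) (at t))"
      by blast
    then have mem: "\<And>t. t \<in> S \<Longrightarrow> c t \<in> H_KN U h" using H by blast
    have d: "\<And>t. t \<in> S \<Longrightarrow> ((\<lambda>s. Complex (x s) (y s)) has_vector_derivative v t) (at t)"
        "\<And>t. t \<in> S \<Longrightarrow> ((\<lambda>s. Complex (\<phi> s) (\<psi> s)) has_vector_derivative w t) (at t)"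
        "\<And>t. t \<in> S \<Longrightarrow> (v has_vector_derivative
             accel_z h (Complex (x t) (y t)) (Complex (\<phi> t) (\<psi> t)) (v t) (w t)) (at t)"
        "\<And>t. t \<in> S \<Longrightarrow> (w has_vector_derivative
             accel_X h (Complex (x t) (y t)) (Complex (\<phi> t) (\<psi> t)) (v t) (w t)) (at t)"
      using * by (auto simp: forall_4 geodesic_field_def)
    define a b where "a t = accel_z h (Complex (x t) (y t)) (Complex (\<phi> t) (\<psi> t)) (v t) (w t)"
      and "b t = accel_X h (Complex (x t) (y t)) (Complex (\<phi> t) (\<psi> t)) (v t) (w t)" for t
    have d': "(v has_vector_derivative a t) (at t)" "(w has_vector_derivative b t) (at t)" if "t \<in> S" for t
      using d(3,4)[OF that] by (simp_all add: a_def b_def)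
    define v' where "v' t = kn_point (Re (v t)) (Re (w t)) (Im (v t)) (Im (w t))" for t
    define a' where "a' t = kn_point (Re (a t)) (Re (b t)) (Im (a t)) (Im (b t))" for t
    have "\<forall>i. ((\<lambda>s. c s $ i) has_field_derivative v' t $ i) (at t)" if "t \<in> S" for t
      using d(1,2)[OF that] by (simp add: forall_4 v'_def kn_point_def has_vector_derivative_Complex_iff)
    moreover have "\<forall>i. ((\<lambda>s. v' s $ i) has_field_derivative a' t $ i) (at t)" if "t \<in> S" for t
      using d'[OF that]
      by (simp add: forall_4 v'_def a'_def kn_point_def has_field_derivative_Re has_field_derivative_Im)
    moreover have "\<forall>i. a' t $ i + (\<Sum>j\<in>UNIV. \<Sum>k\<in>UNIV.
        christoffel (g_KN h) (c t) i j k * v' t $ j * v' t $ k) = 0" if "t \<in> S" for t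
      using chr[OF mem[OF that], of "v' t"]
      by (simp add: forall_4 v'_def a'_def kn_point_def complex_eq_iff a_def b_def)
    ultimately show ?L unfolding geodesic_on_def c_def[symmetric] using mem by blast
  qed
qed

text \<open>The field is composed of coordinates, \<open>h\<close>, \<open>deriv h\<close>, ring
  operations and reciprocals, and membership in \<open>geodesic_state\<close> is exactly what keeps
  the denominators away from zero.\<close>

lemma geodesic_field_locally_lipschitz:
  assumes "open U" "h holomorphic_on U" "q \<in> geodesic_state h U"
  shows "locally_lipschitz_at (geodesic_field h) q"
proof (rule locally_lipschitz_at_vec)
  have q: "q $ 1 \<in> U" "q $ 2 \<noteq> 0" "h (q $ 1) - (q $ 2)\<^sup>2 \<noteq> 0"
    using assms(3) by (auto simp: geodesic_state_def)
  have h: "locally_lipschitz_at (\<lambda>q. h (q $ 1)) q" "locally_lipschitz_at (\<lambda>q. deriv h (q $ 1)) q"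
    using assms(1,2) q by (auto intro!: locally_lipschitz_at_holomorphic_comp[OF locally_lipschitz_at_nth, of U] holomorphic_deriv)
  have pow: "locally_lipschitz_at (\<lambda>x. f x ^ n) q" if "locally_lipschitz_at f q" for f :: "complex ^ 4 \<Rightarrow> complex" and n
    using that by (induction n) (auto intro: locally_lipschitz_at_const locally_lipschitz_at_mult)
  have "\<forall>i. locally_lipschitz_at (\<lambda>q. geodesic_field h q $ i) q"
    unfolding forall_4 geodesic_field_def vector_4_nth accel_z_def accel_X_def divide_inverse
    using q
    by (intro conjI locally_lipschitz_at_nth locally_lipschitz_at_add locally_lipschitz_at_diff
        locally_lipschitz_at_mult locally_lipschitz_at_inverse pow h locally_lipschitz_at_const) auto
  then show "locally_lipschitz_at (\<lambda>q. geodesic_field h q $ i) q" for i ..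
qed

lemma complex_geodesic_exists:
  assumes U: "open U" "h holomorphic_on U" and init: "z0 \<in> U" "X0 \<noteq> 0" "X0\<^sup>2 \<noteq> h z0"
  obtains r Z \<XX> where "r > 0"
    "geodesic_on (G_C h) (H_C U h) (ball 0 r) (\<lambda>\<upsilon>. c_point (Z \<upsilon>) (\<XX> \<upsilon>))"
    "Z 0 = z0" "\<XX> 0 = X0" "deriv Z 0 = v0" "deriv \<XX> 0 = w0"
proof -
  have op: "open (geodesic_state h U)"
  proof -
    have "continuous_on {q::complex^4. q $ 1 \<in> U} (\<lambda>q. h (q $ 1))"
      by (rule continuous_on_compose2[OF holomorphic_on_imp_continuous_on[OF U(2)]])
         (auto intro!: continuous_intros)
    \<comment> \<open>Both inequations defining \<open>geodesic_state\<close> are merged into the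
      nonvanishing of one product, so a single open preimage suffices.\<close>
    then have "continuous_on {q::complex^4. q $ 1 \<in> U} (\<lambda>q. (q $ 2) * (h (q $ 1) - (q $ 2)\<^sup>2))"
      by (intro continuous_intros)
    moreover have "open {q::complex^4. q $ 1 \<in> U}"
      by (rule open_vimage_vec_nth[unfolded vimage_def, OF U(1)])
    ultimately have "open ({q::complex^4. q $ 1 \<in> U} \<inter> (\<lambda>q. (q $ 2) * (h (q $ 1) - (q $ 2)\<^sup>2)) -` (- {0}))"
      by (intro continuous_open_preimage) auto
    also have "\<dots> = geodesic_state h U" by (auto simp: geodesic_state_def)
    finally show ?thesis .
  qed
  define q0 :: "complex ^ 4" where "q0 = vector [z0, X0, v0, w0]"
  have q0: "q0 \<in> geodesic_state h U" using init by (auto simp: geodesic_state_def q0_def)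
  have hol: "(\<lambda>t. geodesic_field h (y t) $ i) holomorphic_on A"
    if A: "open A" "\<And>j. (\<lambda>t. y t $ j) holomorphic_on A" "y ` A \<subseteq> geodesic_state h U" for A y i
  proof -
    have nz: "y t $ 1 \<in> U" "y t $ 2 \<noteq> 0" "h (y t $ 1) - (y t $ 2)\<^sup>2 \<noteq> 0" if "t \<in> A" for t
      using A(3) that by (auto simp: geodesic_state_def)
    have "(h \<circ> (\<lambda>t. y t $ 1)) holomorphic_on A" "(deriv h \<circ> (\<lambda>t. y t $ 1)) holomorphic_on A"
      using U A(2) nz by (auto intro!: holomorphic_on_compose_gen[of _ _ _ U] holomorphic_deriv)
    then have "\<forall>i. (\<lambda>t. geodesic_field h (y t) $ i) holomorphic_on A"
      unfolding forall_4 geodesic_field_def vector_4_nth accel_z_def accel_X_def o_def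
      by (intro conjI holomorphic_intros A(2)) (use nz in auto)
    then show ?thesis ..
  qed
  obtain r y where r: "r > 0" and y0: "y 0 = q0" and mem: "\<And>t. t \<in> ball 0 r \<Longrightarrow> y t \<in> geodesic_state h U"
    and d: "\<And>t i. t \<in> ball 0 r \<Longrightarrow> ((\<lambda>s. y s $ i) has_field_derivative geodesic_field h (y t) $ i) (at t)"
    by (rule holomorphic_ode_exists[OF op q0 geodesic_field_locally_lipschitz[OF U q0] hol]) blast+
  have y: "vector [y t $ 1, y t $ 2, y t $ 3, y t $ 4] = y t" for t by (simp add: vec_eq_iff forall_4)
  show thesis
  proof (rule that[of r "\<lambda>t. y t $ 1" "\<lambda>t. y t $ 2"])
    show "geodesic_on (G_C h) (H_C U h) (ball 0 r) (\<lambda>\<upsilon>. c_point (y \<upsilon> $ 1) (y \<upsilon> $ 2))"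
      unfolding geodesic_on_G_C_iff[OF U]
      by (intro exI[of _ "\<lambda>t. y t $ 3"] exI[of _ "\<lambda>t. y t $ 4"]) (use mem d in \<open>auto simp: y\<close>)
    show "deriv (\<lambda>t. y t $ 1) 0 = v0" "deriv (\<lambda>t. y t $ 2) 0 = w0"
      using d[of 0 1] d[of 0 2] r y0 by (auto intro!: DERIV_imp_deriv simp: geodesic_field_def q0_def)
  qed (use r y0 in \<open>auto simp: q0_def\<close>)
qed

text \<open>A nonzero initial velocity makes \<open>Z\<close> injective on a small disc, and
  \<open>X\<close> is \<open>\<XX>\<close> composed with the inverse of \<open>Z\<close>. The bound
  \<open>\<epsilon>\<close> allows the real trace of the disc to be kept inside a prescribed
  interval.\<close>

lemma explicit_geodesic_exists:
  assumes U: "open U" "h holomorphic_on U" and init: "z0 \<in> U" "X0 \<noteq> 0" "X0\<^sup>2 \<noteq> h z0" "v0 \<noteq> 0" and "\<epsilon> > 0"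
  obtains r U0 Z \<XX> X where "r > 0" "r \<le> \<epsilon>" "explicit_geodesic h U (ball 0 r) U0 Z \<XX> X"
    "Z 0 = z0" "\<XX> 0 = X0" "deriv Z 0 = v0" "deriv \<XX> 0 = w0"
proof -
  obtain r1 Z \<XX> where r1: "r1 > 0"
    and geo: "geodesic_on (G_C h) (H_C U h) (ball 0 r1) (\<lambda>\<upsilon>. c_point (Z \<upsilon>) (\<XX> \<upsilon>))"
    and init': "Z 0 = z0" "\<XX> 0 = X0" "deriv Z 0 = v0" "deriv \<XX> 0 = w0"
    by (rule complex_geodesic_exists[OF U init(1-3)])
  have d: "\<exists>D. (Z has_field_derivative D) (at t)" "\<exists>D. (\<XX> has_field_derivative D) (at t)"
    and ZU: "Z t \<in> U" if "t \<in> ball 0 r1" for t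
    using geo that unfolding geodesic_on_G_C_iff[OF U] by (auto simp: forall_4 geodesic_state_def)
  have hol: "Z holomorphic_on ball 0 r1" "\<XX> holomorphic_on ball 0 r1"
    using d by (auto simp: holomorphic_on_open)
  have "(0::complex) \<in> ball 0 r1" "deriv Z 0 \<noteq> 0" using r1 init(4) init'(3) by auto
  then obtain r2 where r2: "r2 > 0" "ball 0 r2 \<subseteq> ball (0::complex) r1" "inj_on Z (ball 0 r2)"
    using has_complex_derivative_locally_injective[OF hol(1) _ open_ball] by metis
  define r where "r = min r2 \<epsilon>"
  have r: "r > 0" "r \<le> \<epsilon>" "ball 0 r \<subseteq> ball (0::complex) r1" "ball 0 r \<subseteq> ball (0::complex) r2"
    using r2 \<open>\<epsilon> > 0\<close> by (auto simp: r_def)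
  have inj: "inj_on Z (ball 0 r)" using r2(3) r(4) by (rule inj_on_subset)
  have holZ: "Z holomorphic_on ball 0 r" and holX: "\<XX> holomorphic_on ball 0 r"
    using hol r(3) holomorphic_on_subset by blast+
  obtain g where g: "g holomorphic_on (Z ` ball 0 r)" "\<And>z. z \<in> ball 0 r \<Longrightarrow> g (Z z) = z"
    using holomorphic_has_inverse[OF holZ open_ball inj] by metis
  show thesis
  proof (rule that[OF r(1,2), of "Z ` ball 0 r" Z \<XX> "\<XX> \<circ> g"])
    have "(\<XX> \<circ> g) holomorphic_on Z ` ball 0 r"
      by (rule holomorphic_on_compose_gen[OF g(1) holX]) (use g(2) in auto)
    moreover have "open (Z ` ball 0 r)" by (rule open_mapping_thm3[OF holZ open_ball inj])
    moreover have "\<forall>\<upsilon>\<in>ball 0 r. deriv Z \<upsilon> \<noteq> 0"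
      using holomorphic_injective_imp_regular[OF holZ open_ball inj] by blast
    moreover have "geodesic_on (G_C h) (H_C U h) (ball 0 r) (\<lambda>\<upsilon>. c_point (Z \<upsilon>) (\<XX> \<upsilon>))"
      using geo r(3) unfolding geodesic_on_def by blast
    ultimately show "explicit_geodesic h U (ball 0 r) (Z ` ball 0 r) Z \<XX> (\<XX> \<circ> g)"
      unfolding explicit_geodesic_def using r ZU g(2) inj by (auto simp: inj_on_imp_bij_betw)
  qed (use init' in auto)
qed

text \<open>Position and velocity of both curves solve the same autonomous system over the set
  \<open>K\<close> of common real times, with equal values at 0. Convexity of \<open>V\<close> and
  of the interval \<open>J\<close> makes \<open>K\<close> connected, so uniqueness reaches all of
  it.\<close>

lemma real_geodesic_eq_complex_geodesic:
  assumes U: "open U" "h holomorphic_on U"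
    and kn: "kn_geodesic h U J x \<phi> y \<psi>"
    and V: "open V" "convex V" "0 \<in> V"
    and geo: "geodesic_on (G_C h) (H_C U h) V (\<lambda>\<upsilon>. c_point (Z \<upsilon>) (\<XX> \<upsilon>))"
    and init: "same_initial_data Z \<XX> x \<phi> y \<psi>"
    and s: "s \<in> J" "complex_of_real s \<in> V"
  shows "Z (of_real s) = Complex (x s) (y s)" "\<XX> (of_real s) = Complex (\<phi> s) (\<psi> s)"
proof -
  have J: "open J" "convex J" "0 \<in> J"
    and "geodesic_on (g_KN h) (H_KN U h) J (\<lambda>s. kn_point (x s) (\<phi> s) (y s) (\<psi> s))"
    using kn by (auto simp: kn_geodesic_def is_interval_convex_1)
  then obtain v1 w1 where
    mem1: "\<And>t. t \<in> J \<Longrightarrow> vector [Complex (x t) (y t), Complex (\<phi> t) (\<psi> t), v1 t, w1 t] \<in> geodesic_state h U" and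
    d1: "\<And>t i. t \<in> J \<Longrightarrow> ((\<lambda>s. vector [Complex (x s) (y s), Complex (\<phi> s) (\<psi> s), v1 s, w1 s] $ i) has_vector_derivative
             geodesic_field h (vector [Complex (x t) (y t), Complex (\<phi> t) (\<psi> t), v1 t, w1 t]) $ i) (at t)"
    unfolding geodesic_on_g_KN_iff[OF U] by blast
  obtain v2 w2 where
    d2: "\<And>t i. t \<in> V \<Longrightarrow> ((\<lambda>s. vector [Z s, \<XX> s, v2 s, w2 s] $ i) has_field_derivative
             geodesic_field h (vector [Z t, \<XX> t, v2 t, w2 t]) $ i) (at t)"
    using geo unfolding geodesic_on_G_C_iff[OF U] by blast
  define Y1 :: "real \<Rightarrow> complex ^ 4" where "Y1 t = vector [Complex (x t) (y t), Complex (\<phi> t) (\<psi> t), v1 t, w1 t]" for t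
  define Y2 :: "complex \<Rightarrow> complex ^ 4" where "Y2 t = vector [Z t, \<XX> t, v2 t, w2 t]" for t
  define K where "K = J \<inter> complex_of_real -` V"
  have K: "open K" "connected K" "0 \<in> K" "s \<in> K"
  proof -
    show "open K" unfolding K_def using J(1) V(1)
      by (intro open_Int open_vimage) (auto intro!: continuous_intros)
    show "connected K" unfolding K_def
      using J(2) V(2) by (intro convex_connected convex_Int convex_linear_vimage)
        (auto intro!: linearI simp: scaleR_conv_of_real)
  qed (use J V s in \<open>auto simp: K_def\<close>)
  \<comment> \<open>The velocities come from existential statements; they are identified as
    derivatives at 0 before the initial data can be compared.\<close>
  have "Y1 0 = Y2 0"
  proof -
    have "((\<lambda>s. Complex (x s) (y s)) has_vector_derivative v1 0) (at 0)"
      "((\<lambda>s. Complex (\<phi> s) (\<psi> s)) has_vector_derivative w1 0) (at 0)"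
      using d1[OF J(3), of 1] d1[OF J(3), of 2] by (simp_all add: geodesic_field_def)
    then have "v1 0 = Complex (deriv x 0) (deriv y 0)" "w1 0 = Complex (deriv \<phi> 0) (deriv \<psi> 0)"
      unfolding has_vector_derivative_Complex_iff by (auto simp: complex_eq_iff DERIV_imp_deriv)
    moreover have "v2 0 = deriv Z 0" "w2 0 = deriv \<XX> 0"
      using d2[OF V(3), of 1] d2[OF V(3), of 2] by (simp_all add: geodesic_field_def DERIV_imp_deriv)
    ultimately show ?thesis using init by (simp add: Y1_def Y2_def same_initial_data_def)
  qed
  then have "Y1 s = Y2 (of_real s)"
  proof (intro ode_unique[OF K(1-3), of Y1 "\<lambda>s. Y2 (of_real s)" "geodesic_field h" s])
    fix t assume t: "t \<in> K"
    show "(Y1 has_vector_derivative geodesic_field h (Y1 t)) (at t)"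
      using d1[of t] t by (intro has_vector_derivative_vecI) (auto simp: Y1_def K_def)
    show "((\<lambda>s. Y2 (of_real s)) has_vector_derivative geodesic_field h (Y2 (of_real t))) (at t)"
      using d2[of "of_real t"] t
      by (intro has_vector_derivative_vecI) (auto simp: Y2_def K_def intro!: has_vector_derivative_real_field)
    show "locally_lipschitz_at (geodesic_field h) (Y1 t)"
      using mem1[of t] t by (intro geodesic_field_locally_lipschitz[OF U]) (auto simp: Y1_def K_def)
  qed (use K in auto)
  then show "Z (of_real s) = Complex (x s) (y s)" "\<XX> (of_real s) = Complex (\<phi> s) (\<psi> s)"
    by (simp_all add: Y1_def Y2_def vec_eq_iff forall_4)
qed

text \<open>Restricting a holomorphic integral curve to real time is just the chain rule. In the
  conclusion \<open>ball 0 r\<close> is a real interval, in the hypothesis a complex disc.\<close>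

lemma kn_geodesic_of_complex_geodesic:
  assumes U: "open U" "h holomorphic_on U" and "r > 0"
    and geo: "geodesic_on (G_C h) (H_C U h) (ball 0 r) (\<lambda>\<upsilon>. c_point (Z \<upsilon>) (\<XX> \<upsilon>))"
  defines "x \<equiv> \<lambda>s. Re (Z (of_real s))" and "y \<equiv> \<lambda>s. Im (Z (of_real s))"
    and "\<phi> \<equiv> \<lambda>s. Re (\<XX> (of_real s))" and "\<psi> \<equiv> \<lambda>s. Im (\<XX> (of_real s))"
  shows "kn_geodesic h U (ball 0 r) x \<phi> y \<psi>" "same_initial_data Z \<XX> x \<phi> y \<psi>"
proof -
  obtain v w where
    mem: "\<And>t. t \<in> ball 0 r \<Longrightarrow> vector [Z t, \<XX> t, v t, w t] \<in> geodesic_state h U" and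
    d: "\<And>t i. t \<in> ball 0 r \<Longrightarrow> ((\<lambda>s. vector [Z s, \<XX> s, v s, w s] $ i) has_field_derivative
             geodesic_field h (vector [Z t, \<XX> t, v t, w t]) $ i) (at t)"
    using geo unfolding geodesic_on_G_C_iff[OF U] by blast
  have c: "Complex (x s) (y s) = Z (of_real s)" "Complex (\<phi> s) (\<psi> s) = \<XX> (of_real s)" for s
    by (simp_all add: x_def y_def \<phi>_def \<psi>_def)
  have "geodesic_on (g_KN h) (H_KN U h) (ball 0 r) (\<lambda>s. kn_point (x s) (\<phi> s) (y s) (\<psi> s))"
    unfolding geodesic_on_g_KN_iff[OF U] c
    using mem d by (intro exI[of _ "\<lambda>t. v (of_real t)"] exI[of _ "\<lambda>t. w (of_real t)"])
      (auto intro!: has_vector_derivative_real_field)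
  then show "kn_geodesic h U (ball 0 r) x \<phi> y \<psi>"
    using \<open>r > 0\<close> by (auto simp: kn_geodesic_def is_interval_convex_1)
  have D: "(Z has_field_derivative v 0) (at 0)" "(\<XX> has_field_derivative w 0) (at 0)"
    using d[of 0 1] d[of 0 2] \<open>r > 0\<close> by (auto simp: geodesic_field_def)
  then have "((\<lambda>s. Z (of_real s)) has_vector_derivative v 0) (at (0::real))"
    "((\<lambda>s. \<XX> (of_real s)) has_vector_derivative w 0) (at (0::real))"
    by (auto intro!: has_vector_derivative_real_field)
  then show "same_initial_data Z \<XX> x \<phi> y \<psi>"
    using D unfolding same_initial_data_def c[symmetric] has_vector_derivative_Complex_iff
    by (auto simp: complex_eq_iff DERIV_imp_deriv c)
qed

section \<open>Solutions built from an explicit geodesic\<close>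

lemma explicit_ode_denominator:
  fixes x a :: complex
  assumes "x \<noteq> 0" "a - x\<^sup>2 \<noteq> 0"
  defines "e \<equiv> a - x\<^sup>2"
  shows "(3 * x\<^sup>2 + a) / (x\<^sup>2 - a) * (x'\<^sup>2 / x) - b * x' / (x\<^sup>2 - a) + (x ^ 4 - a\<^sup>2) / x
    = b * x' / e - (4 * x\<^sup>2 + e) * x'\<^sup>2 / (e * x) - e * (e + 2 * x\<^sup>2) / x"
proof -
  have e: "x\<^sup>2 - a = - e" "a = e + x\<^sup>2" by (simp_all add: e_def)
  have "e \<noteq> 0" using assms by simp
  then show ?thesis unfolding e(1) using assms(1)
    by (simp add: e(2) field_simps) algebra
qed

text \<open>Differentiating the composite of \<open>X\<close> and \<open>Z\<close> twice gives
  \<open>accel_X = X'' * v\<^sup>2 + X' * accel_z\<close>. The left-hand side is \<open>X''\<close>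
  obtained from this after substituting \<open>w = x' * v\<close> and dividing by
  \<open>v\<^sup>2\<close>.\<close>

lemma accel_quotient:
  fixes x a :: complex
  assumes "x \<noteq> 0" "a - x\<^sup>2 \<noteq> 0"
  shows "x'\<^sup>2 / x - (a\<^sup>2 - x ^ 4) / x - (2 * (a + x\<^sup>2) / (x * (a - x\<^sup>2)) * x' - b / (a - x\<^sup>2)) * x' =
    (3 * x\<^sup>2 + a) / (x\<^sup>2 - a) * (x'\<^sup>2 / x) - b * x' / (x\<^sup>2 - a) + (x ^ 4 - a\<^sup>2) / x"
proof -
  define e where "e = a - x\<^sup>2"
  have a: "a = e + x\<^sup>2" by (simp add: e_def)
  have e: "e \<noteq> 0" using assms by (simp add: e_def)
  have "x'\<^sup>2 / x - ((e + x\<^sup>2)\<^sup>2 - x ^ 4) / x - (2 * (e + x\<^sup>2 + x\<^sup>2) / (x * e) * x' - b / e) * x' =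
    b * x' / e - (4 * x\<^sup>2 + e) * x'\<^sup>2 / (e * x) - e * (e + 2 * x\<^sup>2) / x"
    using e assms(1) by (simp add: divide_simps) algebra
  then show ?thesis
    unfolding explicit_ode_denominator[OF assms] unfolding e_def[symmetric] by (simp only: a[symmetric])
qed

text \<open>On the left stands the derivative of the discriminant with \<open>X''\<close>
  eliminated, on the right twice the \<open>sqrt_rate\<close> times the discriminant.\<close>

lemma discr_identity:
  fixes x a :: complex
  assumes "x \<noteq> 0" "a - x\<^sup>2 \<noteq> 0"
  shows "2 * (a - x\<^sup>2) * (b - 2 * x * x') + 2 * x' *
      ((3 * x\<^sup>2 + a) / (x\<^sup>2 - a) * (x'\<^sup>2 / x) - b * x' / (x\<^sup>2 - a) + (x ^ 4 - a\<^sup>2) / x) =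
    2 * ((b - 4 * x * x') / (a - x\<^sup>2) - x' / x) * ((a - x\<^sup>2)\<^sup>2 + x'\<^sup>2)"
proof -
  define e where "e = a - x\<^sup>2"
  have "e \<noteq> 0" using assms by (simp add: e_def)
  then show ?thesis unfolding explicit_ode_denominator[OF assms] using assms(1)
    unfolding e_def[symmetric]
    by (simp add: divide_simps) algebra
qed

text \<open>The left-hand side is the derivative of \<open>x * ((x' - r) / (a - x\<^sup>2))\<close>,
  with \<open>X''\<close> eliminated and \<open>r\<close> differentiated through its logarithmic
  derivative. It is an identity only modulo the quadratic relation for \<open>r\<close>.\<close>

lemma riccati_identity:
  fixes x a :: complex
  assumes "x \<noteq> 0" "a - x\<^sup>2 \<noteq> 0" "r\<^sup>2 = (a - x\<^sup>2)\<^sup>2 + x'\<^sup>2"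
  shows "x' * ((x' - r) / (a - x\<^sup>2)) + x *
       ((((3 * x\<^sup>2 + a) / (x\<^sup>2 - a) * (x'\<^sup>2 / x) - b * x' / (x\<^sup>2 - a) + (x ^ 4 - a\<^sup>2) / x
            - ((b - 4 * x * x') / (a - x\<^sup>2) - x' / x) * r) * (a - x\<^sup>2)
         - (x' - r) * (b - 2 * x * x')) / (a - x\<^sup>2)\<^sup>2)
       = - a - (x * ((x' - r) / (a - x\<^sup>2)))\<^sup>2"
proof -
  define e where "e = a - x\<^sup>2"
  have a: "a = e + x\<^sup>2" by (simp add: e_def)
  have e: "e \<noteq> 0" using assms by (simp add: e_def)
  have r: "r\<^sup>2 = e\<^sup>2 + x'\<^sup>2" using assms(3) by (simp add: e_def)
  have "x' * ((x' - r) / e) + x *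
       (((b * x' / e - (4 * x\<^sup>2 + e) * x'\<^sup>2 / (e * x) - e * (e + 2 * x\<^sup>2) / x
            - ((b - 4 * x * x') / e - x' / x) * r) * e
         - (x' - r) * (b - 2 * x * x')) / e\<^sup>2)
       = - (e + x\<^sup>2) - (x * ((x' - r) / e))\<^sup>2"
    using e assms(1) r by (simp add: divide_simps) algebra
  then show ?thesis
    unfolding explicit_ode_denominator[OF assms(1,2)] unfolding e_def[symmetric] by (simp only: a[symmetric])
qed

lemma deriv_deriv_eq:
  assumes "open S" "z \<in> S"
    and "\<And>z. z \<in> S \<Longrightarrow> (g has_field_derivative g' z) (at z)"
    and "(g' has_field_derivative d) (at z)"
  shows "deriv (deriv g) z = d"
proof (rule DERIV_imp_deriv)
  show "(deriv g has_field_derivative d) (at z)"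
    by (rule has_field_derivative_transform_within_open[OF assms(4,1,2)])
       (simp add: DERIV_imp_deriv[OF assms(3)])
qed

text \<open>The product of \<open>D\<close> with \<open>exp (- P)\<close> has derivative zero. This
  form of the solution shows at once that \<open>D\<close> vanishes everywhere or nowhere.\<close>

lemma DERIV_const_mult_exp:
  fixes D p :: "complex \<Rightarrow> complex"
  assumes S: "open S" "connected S"
    and D: "\<And>z. z \<in> S \<Longrightarrow> (D has_field_derivative p z * D z) (at z)"
    and P: "\<And>z. z \<in> S \<Longrightarrow> (P has_field_derivative p z) (at z)"
  obtains c where "\<And>z. z \<in> S \<Longrightarrow> D z = c * exp (P z)"
proof -
  have "((\<lambda>z. D z * exp (- P z)) has_field_derivative 0) (at z)" if "z \<in> S" for z
    using D[OF that] P[OF that] by (auto intro!: derivative_eq_intros)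
  then have "(\<lambda>z. D z * exp (- P z)) constant_on S"
    using S(2,1) by (rule has_field_derivative_0_imp_constant_on)
  then obtain c where c: "\<And>z. z \<in> S \<Longrightarrow> D z * exp (- P z) = c" by (auto simp: constant_on_def)
  show thesis by (rule that[of c]) (use c in \<open>force simp: exp_minus field_simps\<close>)
qed

lemma solves_odeI:
  assumes "open S" "\<And>z. z \<in> S \<Longrightarrow> (u has_field_derivative u' z) (at z)"
    "\<And>z. z \<in> S \<Longrightarrow> (u' has_field_derivative - h z * u z) (at z)"
  shows "solves_ode h S u"
  unfolding solves_ode_def using assms deriv_deriv_eq[OF assms(1) _ assms(2,3)]
  by (auto simp: holomorphic_on_open)

text \<open>The Wronskian of any two solutions is constant, since the equation has no first order
  term. Cramer's rule then expresses \<open>u\<close> with quotients of Wronskians as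
  coefficients.\<close>

lemma solves_ode_iff_span:
  assumes S: "open S" "connected S"
    and u1: "\<And>z. z \<in> S \<Longrightarrow> (u1 has_field_derivative u1' z) (at z)"
      "\<And>z. z \<in> S \<Longrightarrow> (u1' has_field_derivative - h z * u1 z) (at z)"
    and u2: "\<And>z. z \<in> S \<Longrightarrow> (u2 has_field_derivative u2' z) (at z)"
      "\<And>z. z \<in> S \<Longrightarrow> (u2' has_field_derivative - h z * u2 z) (at z)"
    and W: "\<And>z. z \<in> S \<Longrightarrow> u1 z * u2' z - u1' z * u2 z \<noteq> 0"
  shows "solves_ode h S u \<longleftrightarrow> (\<exists>A B. \<forall>z\<in>S. u z = A * u1 z + B * u2 z)"
proof
  assume "solves_ode h S u"
  then have u: "(u has_field_derivative deriv u z) (at z)"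
    "(deriv u has_field_derivative - h z * u z) (at z)" if "z \<in> S" for z
    using that S(1) holomorphic_derivI[of u S z] holomorphic_derivI[of "deriv u" S z] holomorphic_deriv
    by (auto simp: solves_ode_def add_eq_0_iff2)
  have wronskian: "\<exists>c. \<forall>z\<in>S. a z * b' z - a' z * b z = c"
    if d: "\<And>z. z \<in> S \<Longrightarrow> (a has_field_derivative a' z) (at z)"
      "\<And>z. z \<in> S \<Longrightarrow> (a' has_field_derivative - h z * a z) (at z)"
      "\<And>z. z \<in> S \<Longrightarrow> (b has_field_derivative b' z) (at z)"
      "\<And>z. z \<in> S \<Longrightarrow> (b' has_field_derivative - h z * b z) (at z)" for a a' b b'
  proof -
    have "((\<lambda>z. a z * b' z - a' z * b z) has_field_derivative 0) (at z)" if "z \<in> S" for z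
      using d[OF that] by (auto intro!: derivative_eq_intros simp: algebra_simps)
    then have "(\<lambda>z. a z * b' z - a' z * b z) constant_on S"
      using S(2,1) by (rule has_field_derivative_0_imp_constant_on)
    then show ?thesis by (auto simp: constant_on_def)
  qed
  obtain c c1 c2 where c: "\<And>z. z \<in> S \<Longrightarrow> u1 z * u2' z - u1' z * u2 z = c"
    "\<And>z. z \<in> S \<Longrightarrow> u z * u2' z - deriv u z * u2 z = c1"
    "\<And>z. z \<in> S \<Longrightarrow> u1 z * deriv u z - u1' z * u z = c2"
    using wronskian[OF u1 u2] wronskian[OF u u2] wronskian[OF u1 u] by metis
  have "u z = c1 / c * u1 z + c2 / c * u2 z" if "z \<in> S" for z
  proof -
    have "u z * c = c1 * u1 z + c2 * u2 z"
      unfolding c(1)[OF that, symmetric] c(2)[OF that, symmetric] c(3)[OF that, symmetric]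
      by (simp add: algebra_simps)
    then show ?thesis using W[OF that] c(1)[OF that] by (simp add: field_simps)
  qed
  then show "\<exists>A B. \<forall>z\<in>S. u z = A * u1 z + B * u2 z" by blast
next
  assume "\<exists>A B. \<forall>z\<in>S. u z = A * u1 z + B * u2 z"
  then obtain A B where u: "\<And>z. z \<in> S \<Longrightarrow> u z = A * u1 z + B * u2 z" by blast
  show "solves_ode h S u"
  proof (rule solves_odeI[OF S(1)])
    fix z assume z: "z \<in> S"
    have "((\<lambda>z. A * u1 z + B * u2 z) has_field_derivative A * u1' z + B * u2' z) (at z)"
      using u1(1)[OF z] u2(1)[OF z] by (auto intro!: derivative_eq_intros)
    then show "(u has_field_derivative A * u1' z + B * u2' z) (at z)"
      by (rule has_field_derivative_transform_within_open[OF _ S(1) z]) (simp add: u)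
    show "((\<lambda>z. A * u1' z + B * u2' z) has_field_derivative - h z * u z) (at z)"
      using u1(2)[OF z] u2(2)[OF z] by (auto intro!: derivative_eq_intros simp: u[OF z] algebra_simps)
  qed
qed

section \<open>One explicit geodesic over a convex parameter domain\<close>

locale explicit_complex_geodesic =
  fixes h :: "complex \<Rightarrow> complex" and U V0 U0 :: "complex set" and Z \<XX> X :: "complex \<Rightarrow> complex"
  assumes open_U: "open U" and h: "h holomorphic_on U" and convex_V0: "convex V0"
    and explicit: "explicit_geodesic h U V0 U0 Z \<XX> X"
begin

text \<open>The affine parameter as a function on \<open>U0\<close>, the same inverse that
  \<open>geodesic_path\<close> uses to find its endpoint.\<close>

definition param :: "complex \<Rightarrow> complex" where "param = inv_into V0 Z"

lemma
  shows open_V0: "open V0" and zero_V0: "0 \<in> V0" and open_U0: "open U0" and U0_subset: "U0 \<subseteq> U"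
    and geodesic: "geodesic_on (G_C h) (H_C U h) V0 (\<lambda>\<upsilon>. c_point (Z \<upsilon>) (\<XX> \<upsilon>))"
    and deriv_Z: "\<And>t. t \<in> V0 \<Longrightarrow> deriv Z t \<noteq> 0" and bij: "bij_betw Z V0 U0"
    and X_hol: "X holomorphic_on U0" and XX: "\<And>t. t \<in> V0 \<Longrightarrow> \<XX> t = X (Z t)"
  using explicit by (auto simp: explicit_geodesic_def)

lemma param_in: "z \<in> U0 \<Longrightarrow> param z \<in> V0" and Z_param: "z \<in> U0 \<Longrightarrow> Z (param z) = z"
  and param_Z: "t \<in> V0 \<Longrightarrow> param (Z t) = t" and Z_in: "t \<in> V0 \<Longrightarrow> Z t \<in> U0"
  using bij unfolding param_def bij_betw_def by (auto simp: inv_into_into f_inv_into_f)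

lemma geodesic_D:
  obtains v w where "\<And>t. t \<in> V0 \<Longrightarrow> Z t \<in> U" "\<And>t. t \<in> V0 \<Longrightarrow> \<XX> t \<noteq> 0"
    "\<And>t. t \<in> V0 \<Longrightarrow> h (Z t) - (\<XX> t)\<^sup>2 \<noteq> 0"
    "\<And>t. t \<in> V0 \<Longrightarrow> (Z has_field_derivative v t) (at t)"
    "\<And>t. t \<in> V0 \<Longrightarrow> (\<XX> has_field_derivative w t) (at t)"
    "\<And>t. t \<in> V0 \<Longrightarrow> (v has_field_derivative accel_z h (Z t) (\<XX> t) (v t) (w t)) (at t)"
    "\<And>t. t \<in> V0 \<Longrightarrow> (w has_field_derivative accel_X h (Z t) (\<XX> t) (v t) (w t)) (at t)"
proof -
  obtain v w where *: "\<forall>t\<in>V0. vector [Z t, \<XX> t, v t, w t] \<in> geodesic_state h U \<and>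
      (\<forall>i. ((\<lambda>s. vector [Z s, \<XX> s, v s, w s] $ i) has_field_derivative
             geodesic_field h (vector [Z t, \<XX> t, v t, w t]) $ i) (at t))"
    using geodesic unfolding geodesic_on_G_C_iff[OF open_U h] by blast
  show thesis
    by (rule that[of v w]) (use * in \<open>auto simp: forall_4 geodesic_field_def geodesic_state_def\<close>)
qed

lemma Z_hol: "Z holomorphic_on V0"
  using geodesic_D holomorphic_on_open[OF open_V0] by metis

lemma param_DERIV: "z \<in> U0 \<Longrightarrow> (param has_field_derivative inverse (deriv Z (param z))) (at z)"
  using holomorphic_derivI[OF Z_hol open_V0 param_in]
  by (rule has_field_derivative_inverse_strong_x[of Z _ param z V0])
     (auto simp: param_in Z_param param_Z deriv_Z open_V0 holomorphic_on_imp_continuous_on Z_hol)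

lemma connected_U0: "connected U0"
  using connected_continuous_image[OF holomorphic_on_imp_continuous_on[OF Z_hol] convex_connected[OF convex_V0]]
    bij by (simp add: bij_betw_def)

lemma X_nonzero: "z \<in> U0 \<Longrightarrow> X z \<noteq> 0" and h_ne_X2: "z \<in> U0 \<Longrightarrow> h z - (X z)\<^sup>2 \<noteq> 0"
proof -
  assume z: "z \<in> U0"
  show "X z \<noteq> 0" using geodesic_D XX param_in[OF z] Z_param[OF z] by metis
  show "h z - (X z)\<^sup>2 \<noteq> 0" using geodesic_D XX param_in[OF z] Z_param[OF z] by metis
qed

lemma h_DERIV: "z \<in> U0 \<Longrightarrow> (h has_field_derivative deriv h z) (at z)"
  using holomorphic_derivI[OF h open_U] U0_subset by blast

lemma X_DERIV: "z \<in> U0 \<Longrightarrow> (X has_field_derivative deriv X z) (at z)"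
  and X'_DERIV': "z \<in> U0 \<Longrightarrow> (deriv X has_field_derivative deriv (deriv X) z) (at z)"
  using holomorphic_derivI[OF X_hol open_U0] holomorphic_derivI[OF holomorphic_deriv[OF X_hol open_U0] open_U0]
  by auto

text \<open>Elimination of the parameter: \<open>\<XX>\<close> is \<open>X\<close> composed with
  \<open>Z\<close>, differentiated twice and compared with the second geodesic equation; the common
  factor \<open>(v t)\<^sup>2\<close> cancels because \<open>deriv Z\<close> does not
  vanish.\<close>

lemma X_ode:
  assumes z: "z \<in> U0"
  shows "deriv (deriv X) z = (3 * (X z)\<^sup>2 + h z) / ((X z)\<^sup>2 - h z) * ((deriv X z)\<^sup>2 / X z)
           - deriv h z * deriv X z / ((X z)\<^sup>2 - h z) + ((X z) ^ 4 - (h z)\<^sup>2) / X z"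
proof -
  obtain v w where
    dZ: "\<And>t. t \<in> V0 \<Longrightarrow> (Z has_field_derivative v t) (at t)" and
    dX: "\<And>t. t \<in> V0 \<Longrightarrow> (\<XX> has_field_derivative w t) (at t)" and
    dv: "\<And>t. t \<in> V0 \<Longrightarrow> (v has_field_derivative accel_z h (Z t) (\<XX> t) (v t) (w t)) (at t)" and
    dw: "\<And>t. t \<in> V0 \<Longrightarrow> (w has_field_derivative accel_X h (Z t) (\<XX> t) (v t) (w t)) (at t)"
    by (rule geodesic_D) blast
  have w: "w t = deriv X (Z t) * v t" if t: "t \<in> V0" for t
  proof -
    have "((\<lambda>t. X (Z t)) has_field_derivative deriv X (Z t) * v t) (at t)"
      using DERIV_chain2[OF X_DERIV[OF Z_in[OF t]] dZ[OF t]] .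
    then have "(\<XX> has_field_derivative deriv X (Z t) * v t) (at t)"
      by (rule has_field_derivative_transform_within_open[OF _ open_V0 t]) (simp add: XX)
    then show ?thesis using DERIV_unique dX[OF t] by blast
  qed
  define t where "t = param z"
  have t: "t \<in> V0" "Z t = z" "\<XX> t = X z" using param_in Z_param XX z by (auto simp: t_def)
  have vt: "v t \<noteq> 0" using deriv_Z[OF t(1)] DERIV_imp_deriv[OF dZ[OF t(1)]] by simp
  define x x' x'' a b where "x = X z" and "x' = deriv X z" and "x'' = deriv (deriv X) z"
    and "a = h z" and "b = deriv h z"
  have "((\<lambda>t. deriv X (Z t) * v t) has_field_derivative
      x'' * v t * v t + accel_z h z x (v t) (w t) * x') (at t)"
    using DERIV_mult[OF DERIV_chain2[OF X'_DERIV'[OF Z_in[OF t(1)]] dZ[OF t(1)]] dv[OF t(1)]]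
    by (simp add: t x_def x'_def x''_def)
  then have "(w has_field_derivative x'' * v t * v t + accel_z h z x (v t) (w t) * x') (at t)"
    by (rule has_field_derivative_transform_within_open[OF _ open_V0 t(1)]) (simp add: w)
  then have "x'' * v t * v t + accel_z h z x (v t) (w t) * x' = accel_X h z x (v t) (w t)"
    using DERIV_unique dw[OF t(1)] t by (simp add: x_def)
  moreover have "w t = x' * v t" using w[OF t(1)] t by (simp add: x'_def)
  ultimately have "(v t)\<^sup>2 * (x'' + (2 * (a + x\<^sup>2) / (x * (a - x\<^sup>2)) * x' - b / (a - x\<^sup>2)) * x') =
      (v t)\<^sup>2 * (x'\<^sup>2 / x - (a\<^sup>2 - x ^ 4) / x)"
    by (simp add: accel_z_def accel_X_def a_def b_def power2_eq_square algebra_simps)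
  then have "x'' = x'\<^sup>2 / x - (a\<^sup>2 - x ^ 4) / x - (2 * (a + x\<^sup>2) / (x * (a - x\<^sup>2)) * x' - b / (a - x\<^sup>2)) * x'"
    using vt by (simp add: eq_diff_eq)
  moreover have "x \<noteq> 0" "a - x\<^sup>2 \<noteq> 0"
    using X_nonzero[OF z] h_ne_X2[OF z] by (auto simp: x_def a_def)
  ultimately have "x'' = (3 * x\<^sup>2 + a) / (x\<^sup>2 - a) * (x'\<^sup>2 / x) - b * x' / (x\<^sup>2 - a) + (x ^ 4 - a\<^sup>2) / x"
    by (rule trans[OF _ accel_quotient])
  then show ?thesis by (simp add: x_def x'_def x''_def a_def b_def)
qed

text \<open>\<open>U0\<close> itself need not be convex, so \<open>f\<close> is pulled back to
  \<open>V0\<close> by the substitution \<open>z = Z t\<close>, integrated there, and the result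
  composed with \<open>param\<close>.\<close>

lemma primitive:
  assumes f: "f holomorphic_on U0"
  obtains F where "\<And>z. z \<in> U0 \<Longrightarrow> (F has_field_derivative f z) (at z)"
proof -
  have "(\<lambda>t. (f \<circ> Z) t * deriv Z t) holomorphic_on V0"
    using f Z_hol open_V0 Z_in
    by (intro holomorphic_intros holomorphic_on_compose_gen[of _ _ _ U0] holomorphic_deriv) auto
  then have "(\<lambda>t. f (Z t) * deriv Z t) holomorphic_on V0" by simp
  then obtain G where G: "\<And>t. t \<in> V0 \<Longrightarrow> (G has_field_derivative f (Z t) * deriv Z t) (at t within V0)"
    using holomorphic_convex_primitive'[OF convex_V0 open_V0] by blast
  show thesis
  proof (rule that[of "\<lambda>z. G (param z)"])
    fix z assume z: "z \<in> U0"
    have "(G has_field_derivative f z * deriv Z (param z)) (at (param z))"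
      using G[OF param_in[OF z]] by (simp add: at_within_open[OF param_in[OF z] open_V0] Z_param[OF z])
    then show "((\<lambda>z. G (param z)) has_field_derivative f z) (at z)"
      using DERIV_cong[OF DERIV_chain2[OF _ param_DERIV[OF z]]] deriv_Z[OF param_in[OF z]] by force
  qed
qed

text \<open>The logarithmic derivative of a square root of the discriminant.\<close>

definition sqrt_rate :: "complex \<Rightarrow> complex" where
  "sqrt_rate z = (deriv h z - 4 * X z * deriv X z) / (h z - (X z)\<^sup>2) - deriv X z / X z"

lemma sqrt_rate_hol: "sqrt_rate holomorphic_on U0"
  unfolding sqrt_rate_def using X_nonzero h_ne_X2 holomorphic_on_subset[OF h U0_subset]
    holomorphic_on_subset[OF holomorphic_deriv[OF h open_U] U0_subset]
  by (intro holomorphic_intros X_hol holomorphic_deriv open_U0) auto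

lemma discr_DERIV:
  assumes z: "z \<in> U0"
  shows "(discr h X has_field_derivative 2 * sqrt_rate z * discr h X z) (at z)"
proof -
  have "(discr h X has_field_derivative 2 * (h z - (X z)\<^sup>2) * (deriv h z - 2 * X z * deriv X z)
      + 2 * deriv X z * deriv (deriv X) z) (at z)"
    unfolding discr_def using h_DERIV[OF z] X_DERIV[OF z] X'_DERIV'[OF z]
    by (auto intro!: derivative_eq_intros simp: algebra_simps)
  moreover have "2 * (h z - (X z)\<^sup>2) * (deriv h z - 2 * X z * deriv X z)
      + 2 * deriv X z * deriv (deriv X) z = 2 * sqrt_rate z * discr h X z"
  proof -
    have "X z \<noteq> 0" "h z - (X z)\<^sup>2 \<noteq> 0" using X_nonzero[OF z] h_ne_X2[OF z] by auto
    then show ?thesis unfolding sqrt_rate_def discr_def X_ode[OF z] by (rule discr_identity)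
  qed
  ultimately show ?thesis by simp
qed

text \<open>Differentiating \<open>R\<^sup>2\<close> and dividing by \<open>R\<close> is possible
  only where \<open>R\<close> is nonzero. Since the discriminant is a constant times an exponential,
  \<open>R\<close> is otherwise identically zero and the claim is trivial.\<close>

lemma sqrt_branch_DERIV:
  assumes R: "sqrt_branch h U0 X R" and z: "z \<in> U0"
  shows "(R has_field_derivative sqrt_rate z * R z) (at z)"
proof -
  obtain Q where Q: "\<And>z. z \<in> U0 \<Longrightarrow> (Q has_field_derivative 2 * sqrt_rate z) (at z)"
    using primitive[OF holomorphic_on_mult[OF holomorphic_on_const sqrt_rate_hol], of 2] by blast
  obtain c where c: "\<And>z. z \<in> U0 \<Longrightarrow> discr h X z = c * exp (Q z)"
    using DERIV_const_mult_exp[OF open_U0 connected_U0 discr_DERIV Q] by blast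
  have R2: "\<And>z. z \<in> U0 \<Longrightarrow> (R z)\<^sup>2 = discr h X z" and Rh: "R holomorphic_on U0"
    using R by (auto simp: sqrt_branch_def)
  have dR: "(R has_field_derivative deriv R z) (at z)"
    using holomorphic_derivI[OF Rh open_U0 z] .
  show ?thesis
  proof (cases "c = 0")
    case True
    then have R0: "R y = 0" if "y \<in> U0" for y using R2 c that by force
    have "(R has_field_derivative 0) (at z)"
      by (rule has_field_derivative_transform_within_open[OF DERIV_const open_U0 z]) (simp add: R0)
    then show ?thesis by (simp add: R0[OF z])
  next
    case False
    then have "R z \<noteq> 0" using R2[OF z] c[OF z] by auto
    have "((\<lambda>z. (R z)\<^sup>2) has_field_derivative 2 * deriv R z * R z) (at z)"
      using dR by (auto intro!: derivative_eq_intros)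
    then have "(discr h X has_field_derivative 2 * deriv R z * R z) (at z)"
      by (rule has_field_derivative_transform_within_open[OF _ open_U0 z]) (simp add: R2)
    then have "2 * deriv R z * R z = 2 * sqrt_rate z * (R z)\<^sup>2"
      using DERIV_unique discr_DERIV[OF z] R2[OF z] by metis
    then have "deriv R z = sqrt_rate z * R z" using \<open>R z \<noteq> 0\<close> by (simp add: power2_eq_square)
    then show ?thesis using dR by simp
  qed
qed

lemma discr_nonzero:
  assumes "y \<in> U0" "discr h X y \<noteq> 0" "z \<in> U0"
  shows "discr h X z \<noteq> 0"
proof -
  obtain Q where Q: "\<And>z. z \<in> U0 \<Longrightarrow> (Q has_field_derivative 2 * sqrt_rate z) (at z)"
    using primitive[OF holomorphic_on_mult[OF holomorphic_on_const sqrt_rate_hol], of 2] by blast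
  obtain c where c: "\<And>z. z \<in> U0 \<Longrightarrow> discr h X z = c * exp (Q z)"
    using DERIV_const_mult_exp[OF open_U0 connected_U0 discr_DERIV Q] by blast
  show ?thesis using c assms by auto
qed

lemma sqrt_branch_exists: "\<exists>R. sqrt_branch h U0 X R"
proof -
  obtain Q where Q: "\<And>z. z \<in> U0 \<Longrightarrow> (Q has_field_derivative sqrt_rate z) (at z)"
    using primitive[OF sqrt_rate_hol] by blast
  have "((\<lambda>z. 2 * Q z) has_field_derivative 2 * sqrt_rate z) (at z)" if "z \<in> U0" for z
    using Q[OF that] by (rule DERIV_cmult)
  then obtain c where c: "\<And>z. z \<in> U0 \<Longrightarrow> discr h X z = c * exp (2 * Q z)"
    using DERIV_const_mult_exp[OF open_U0 connected_U0 discr_DERIV] by blast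
  have "Q holomorphic_on U0" using Q by (auto simp: holomorphic_on_open[OF open_U0])
  \<comment> \<open>Halving the exponent takes the root. \<open>csqrt\<close> is applied to a
    constant only, so its branch cut does no harm.\<close>
  then have "sqrt_branch h U0 X (\<lambda>z. csqrt c * exp (Q z))"
    unfolding sqrt_branch_def
    by (auto intro!: holomorphic_intros simp: c power_mult_distrib simp flip: exp_double)
  then show ?thesis by blast
qed

text \<open>The integrand in the exponent of \<open>u_top\<close>, hence its logarithmic
  derivative.\<close>

definition riccati :: "(complex \<Rightarrow> complex) \<Rightarrow> complex \<Rightarrow> complex" where
  "riccati R z = X z * ((deriv X z - R z) / (h z - (X z)\<^sup>2))"

lemma riccati_DERIV:
  assumes R: "sqrt_branch h U0 X R" and z: "z \<in> U0"
  shows "(riccati R has_field_derivative - h z - (riccati R z)\<^sup>2) (at z)"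
proof -
  have nz: "X z \<noteq> 0" "h z - (X z)\<^sup>2 \<noteq> 0" using X_nonzero[OF z] h_ne_X2[OF z] by auto
  have den: "((\<lambda>z. h z - (X z)\<^sup>2) has_field_derivative deriv h z - 2 * X z * deriv X z) (at z)"
    using h_DERIV[OF z] X_DERIV[OF z] by (auto intro!: derivative_eq_intros)
  have "(riccati R has_field_derivative
      deriv X z * ((deriv X z - R z) / (h z - (X z)\<^sup>2)) + X z *
       (((deriv (deriv X) z - sqrt_rate z * R z) * (h z - (X z)\<^sup>2) -
         (deriv X z - R z) * (deriv h z - 2 * X z * deriv X z)) / (h z - (X z)\<^sup>2)\<^sup>2)) (at z)"
    unfolding riccati_def[abs_def]
    by (rule DERIV_cong[OF DERIV_mult[OF X_DERIV[OF z]
          DERIV_divide[OF DERIV_diff[OF X'_DERIV'[OF z] sqrt_branch_DERIV[OF R z]] den nz(2)]]])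
       (simp add: power2_eq_square mult.commute)
  moreover have "deriv X z * ((deriv X z - R z) / (h z - (X z)\<^sup>2)) + X z *
       (((deriv (deriv X) z - sqrt_rate z * R z) * (h z - (X z)\<^sup>2) -
         (deriv X z - R z) * (deriv h z - 2 * X z * deriv X z)) / (h z - (X z)\<^sup>2)\<^sup>2)
       = - h z - (riccati R z)\<^sup>2"
  proof -
    have "(R z)\<^sup>2 = (h z - (X z)\<^sup>2)\<^sup>2 + (deriv X z)\<^sup>2"
      using R z by (simp add: sqrt_branch_def discr_def)
    then show ?thesis using nz(1,2) unfolding sqrt_rate_def riccati_def X_ode[OF z] by (intro riccati_identity)
  qed
  ultimately show ?thesis by simp
qed

text \<open>\<open>geodesic_path\<close> is the image under \<open>Z\<close> of the segment from 0
  to \<open>param z\<close>, so the integral is the increment of a primitive of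
  \<open>riccati R\<close>. The Riccati equation turns the derivative of
  \<open>riccati R * u\<close> into \<open>- h * u\<close>.\<close>

lemma u_top_DERIV:
  assumes R: "sqrt_branch h U0 X R" and z: "z \<in> U0"
  defines "u \<equiv> u_top h X R (geodesic_path V0 Z)"
  shows "(u has_field_derivative riccati R z * u z) (at z)"
    and "((\<lambda>z. riccati R z * u z) has_field_derivative - h z * u z) (at z)"
proof -
  have "riccati R holomorphic_on U0"
    using riccati_DERIV[OF R] by (auto simp: holomorphic_on_open[OF open_U0])
  then obtain F where F: "\<And>z. z \<in> U0 \<Longrightarrow> (F has_field_derivative riccati R z) (at z)"
    using primitive by blast
  have u: "u z = exp (F z - F (Z 0))" if z: "z \<in> U0" for z
  proof -
    have path: "geodesic_path V0 Z z = Z \<circ> linepath 0 (param z)"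
      by (auto simp: geodesic_path_def param_def linepath_def scaleR_conv_of_real mult.commute)
    have seg: "path_image (linepath 0 (param z)) \<subseteq> V0"
      using convex_V0 zero_V0 param_in[OF z] by (simp add: convex_contains_segment)
    have "(riccati R has_contour_integral F (pathfinish (geodesic_path V0 Z z)) - F (pathstart (geodesic_path V0 Z z)))
        (geodesic_path V0 Z z)"
    proof (rule contour_integral_primitive)
      show "(F has_field_derivative riccati R y) (at y within U0)" if "y \<in> U0" for y
        using F[OF that] by (rule has_field_derivative_at_within)
      show "valid_path (geodesic_path V0 Z z)"
        unfolding path by (rule valid_path_compose_holomorphic[OF _ Z_hol open_V0 seg]) simp
      show "path_image (geodesic_path V0 Z z) \<subseteq> U0"
        unfolding path path_image_compose using seg Z_in by blast
    qed
    then have "contour_integral (geodesic_path V0 Z z) (riccati R) = F z - F (Z 0)"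
      by (intro contour_integral_unique) (simp add: path pathfinish_compose pathstart_compose Z_param[OF z])
    then show ?thesis by (simp add: u_def u_top_def riccati_def[abs_def])
  qed
  have "((\<lambda>z. exp (F z - F (Z 0))) has_field_derivative riccati R z * exp (F z - F (Z 0))) (at z)"
    using F[OF z] by (auto intro!: derivative_eq_intros)
  then have "(u has_field_derivative riccati R z * exp (F z - F (Z 0))) (at z)"
    by (rule has_field_derivative_transform_within_open[OF _ open_U0 z]) (simp add: u)
  then show *: "(u has_field_derivative riccati R z * u z) (at z)" using u[OF z] by simp
  show "((\<lambda>z. riccati R z * u z) has_field_derivative - h z * u z) (at z)"
    using DERIV_mult[OF riccati_DERIV[OF R z] *] by (simp add: power2_eq_square algebra_simps)
qed

lemma sqrt_branch_uminus: "sqrt_branch h U0 X R \<Longrightarrow> sqrt_branch h U0 X (\<lambda>z. - R z)"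
  by (auto simp: sqrt_branch_def intro!: holomorphic_intros)

text \<open>Changing the sign of the branch exchanges the two solutions, so results on
  \<open>u_top\<close> for every branch carry over to \<open>u_bot\<close>.\<close>

lemma u_bot_eq: "u_bot h X R \<gamma> = u_top h X (\<lambda>z. - R z) \<gamma>"
  by (rule ext) (simp add: u_bot_def u_top_def)

lemma solves_ode_u_top: "sqrt_branch h U0 X R \<Longrightarrow> solves_ode h U0 (u_top h X R (geodesic_path V0 Z))"
  by (rule solves_odeI[OF open_U0 u_top_DERIV])

text \<open>The Wronskian is the product of the two solutions, which are exponentials, with the
  difference of their logarithmic derivatives, \<open>2 * X * R / (h - X\<^sup>2)\<close>. One point
  with nonzero discriminant makes \<open>R\<close> nonzero throughout.\<close>

lemma general_solution:
  assumes R: "sqrt_branch h U0 X R" and D: "y \<in> U0" "discr h X y \<noteq> 0"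
  shows "solves_ode h U0 u \<longleftrightarrow> (\<exists>A B. \<forall>z\<in>U0. u z = A * u_top h X R (geodesic_path V0 Z) z
                                       + B * u_bot h X R (geodesic_path V0 Z) z)"
  unfolding u_bot_eq
proof (rule solves_ode_iff_span[OF open_U0 connected_U0 u_top_DERIV[OF R] u_top_DERIV[OF sqrt_branch_uminus[OF R]]])
  fix z assume z: "z \<in> U0"
  have "R z \<noteq> 0" using discr_nonzero[OF D z] R z by (auto simp: sqrt_branch_def)
  moreover have "riccati (\<lambda>z. - R z) z - riccati R z = 2 * X z * R z / (h z - (X z)\<^sup>2)"
    by (simp add: riccati_def diff_divide_distrib add_divide_distrib algebra_simps)
  ultimately have ne: "riccati (\<lambda>z. - R z) z - riccati R z \<noteq> 0"
    using X_nonzero[OF z] h_ne_X2[OF z] by simp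
  let ?a = "u_top h X R (geodesic_path V0 Z) z" and ?b = "u_top h X (\<lambda>z. - R z) (geodesic_path V0 Z) z"
  have "?a * (riccati (\<lambda>z. - R z) z * ?b) - riccati R z * ?a * ?b =
      ?a * ?b * (riccati (\<lambda>z. - R z) z - riccati R z)" by (simp add: algebra_simps)
  also have "\<dots> \<noteq> 0" using ne by (simp add: u_top_def)
  finally show "?a * (riccati (\<lambda>z. - R z) z * ?b) - riccati R z * ?a * ?b \<noteq> 0" .
qed

end

text \<open>The first conjunct keeps the second from being vacuous: over every point of
  \<open>U\<close> there is a real geodesic whose complex extension has a discriminant that is not
  identically zero. The second treats an arbitrary real geodesic whose \<open>z\<close>-velocity at
  0 is nonzero, as an explicit form demands.\<close>

theorem theorem11:
  fixes U :: "complex set" and h :: "complex \<Rightarrow> complex"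
  assumes "open U" and "h holomorphic_on U"
  shows
    "(\<forall>z0\<in>U. \<exists>J x \<phi> y \<psi> V0 U0 Z \<XX> X.
        kn_geodesic h U J x \<phi> y \<psi> \<and> Complex (x 0) (y 0) = z0 \<and>
        convex V0 \<and> explicit_geodesic h U V0 U0 Z \<XX> X \<and>
        same_initial_data Z \<XX> x \<phi> y \<psi> \<and>
        (\<forall>s. complex_of_real s \<in> V0 \<longrightarrow> s \<in> J) \<and>
        (\<exists>z\<in>U0. discr h X z \<noteq> 0))
     \<and>
     (\<forall>J x \<phi> y \<psi>.
        kn_geodesic h U J x \<phi> y \<psi> \<and> Complex (deriv x 0) (deriv y 0) \<noteq> 0 \<longrightarrow>
        (\<exists>V0 U0 Z \<XX> X.
           convex V0 \<and> explicit_geodesic h U V0 U0 Z \<XX> X \<and>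
           same_initial_data Z \<XX> x \<phi> y \<psi> \<and>
           (\<forall>s. complex_of_real s \<in> V0 \<longrightarrow> s \<in> J))
        \<and>
        (\<forall>V0 U0 Z \<XX> X.
           convex V0 \<and> explicit_geodesic h U V0 U0 Z \<XX> X \<and>
           same_initial_data Z \<XX> x \<phi> y \<psi> \<longrightarrow>
           (\<exists>\<Phi> \<Psi> :: real \<Rightarrow> real \<Rightarrow> real.
              (\<forall>a b. Complex a b \<in> U0 \<longrightarrow>
                 X (Complex a b) = complex_of_real (\<Phi> a b) + \<i> * complex_of_real (\<Psi> a b)) \<and>
              (\<forall>s\<in>J. complex_of_real s \<in> V0 \<longrightarrow>
                 x s = Re (Z (of_real s)) \<and> y s = Im (Z (of_real s)) \<and>
                 \<Phi> (x s) (y s) = \<phi> s \<and> \<phi> s = Re (\<XX> (of_real s)) \<and>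
                 \<phi> s = Re (X (Z (of_real s))) \<and>
                 \<Psi> (x s) (y s) = \<psi> s \<and> \<psi> s = Im (\<XX> (of_real s)) \<and>
                 \<psi> s = Im (X (Z (of_real s))))) \<and>
           (\<forall>t\<in>J. complex_of_real t \<in> V0 \<longrightarrow>
              (\<forall>s\<in>{0..1}. geodesic_path V0 Z (Complex (x t) (y t)) s
                             = Complex (x (t * s)) (y (t * s)))) \<and>
           (\<forall>z\<in>U0. X z \<noteq> 0 \<and> h z \<noteq> (X z)\<^sup>2 \<and>
              deriv (deriv X) z =
                (3 * (X z)\<^sup>2 + h z) / ((X z)\<^sup>2 - h z) * ((deriv X z)\<^sup>2 / X z)
                - deriv h z * deriv X z / ((X z)\<^sup>2 - h z)
                + ((X z) ^ 4 - (h z)\<^sup>2) / X z) \<and>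
           (\<exists>R. sqrt_branch h U0 X R) \<and>
           (\<forall>R. sqrt_branch h U0 X R \<longrightarrow>
              solves_ode h U0 (u_top h X R (geodesic_path V0 Z)) \<and>
              solves_ode h U0 (u_bot h X R (geodesic_path V0 Z)) \<and>
              ((\<exists>z\<in>U0. discr h X z \<noteq> 0) \<longrightarrow>
                 (\<forall>u. solves_ode h U0 u \<longleftrightarrow>
                    (\<exists>A B. \<forall>z\<in>U0. u z = A * u_top h X R (geodesic_path V0 Z) z
                                       + B * u_bot h X R (geodesic_path V0 Z) z))))))"
proof (rule conjI; (rule ballI | (intro allI impI conjI; elim conjE)))
  fix z0 assume z0: "z0 \<in> U"
  have "\<exists>X0. X0 \<noteq> 0 \<and> X0\<^sup>2 \<noteq> h z0"
  proof (cases "h z0 = 1")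
    case True
    then show ?thesis by (intro exI[of _ 2]) auto
  next
    case False
    then show ?thesis by (intro exI[of _ 1]) auto
  qed
  then obtain X0 where X0: "X0 \<noteq> 0" "X0\<^sup>2 \<noteq> h z0" by blast
  \<comment> \<open>The zero initial velocity of \<open>\<XX>\<close> forces
    \<open>deriv X z0 = 0\<close>, so that the discriminant at \<open>z0\<close> reduces to a
    nonzero square.\<close>
  obtain r U0 Z \<XX> X where r: "r > 0" and expl: "explicit_geodesic h U (ball 0 r) U0 Z \<XX> X"
    and init: "Z 0 = z0" "\<XX> 0 = X0" "deriv Z 0 = 1" "deriv \<XX> 0 = 0"
    by (rule explicit_geodesic_exists[OF assms z0 X0, of 1 1 0]) simp_all
  interpret explicit_complex_geodesic h U "ball 0 r" U0 Z \<XX> X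
    by standard (use assms expl in auto)
  have z0': "z0 \<in> U0" using Z_in[of 0] r init(1) by simp
  have "deriv X z0 = 0"
  proof -
    have "((\<lambda>t. X (Z t)) has_field_derivative deriv X z0 * deriv Z 0) (at 0)"
      using DERIV_chain2[of X _ Z 0, OF _ holomorphic_derivI[OF Z_hol open_ball]] X_DERIV[OF z0'] r init(1)
      by simp
    then have "(\<XX> has_field_derivative deriv X z0 * deriv Z 0) (at 0)"
      by (rule has_field_derivative_transform_within_open[OF _ open_ball[of 0 r]]) (use r XX in auto)
    then show ?thesis using init DERIV_imp_deriv by fastforce
  qed
  then have "discr h X z0 \<noteq> 0" using h_ne_X2[OF z0'] by (simp add: discr_def)
  moreover note kn_geodesic_of_complex_geodesic[OF assms r geodesic]
  ultimately show "\<exists>J x \<phi> y \<psi> V0 U0 Z \<XX> X.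
      kn_geodesic h U J x \<phi> y \<psi> \<and> Complex (x 0) (y 0) = z0 \<and>
      convex V0 \<and> explicit_geodesic h U V0 U0 Z \<XX> X \<and>
      same_initial_data Z \<XX> x \<phi> y \<psi> \<and>
      (\<forall>s. complex_of_real s \<in> V0 \<longrightarrow> s \<in> J) \<and>
      (\<exists>z\<in>U0. discr h X z \<noteq> 0)"
    using expl z0' init(1)
    by - (rule exI[of _ "ball 0 r"], rule exI[of _ "\<lambda>s. Re (Z (of_real s))"],
      rule exI[of _ "\<lambda>s. Re (\<XX> (of_real s))"], rule exI[of _ "\<lambda>s. Im (Z (of_real s))"],
      rule exI[of _ "\<lambda>s. Im (\<XX> (of_real s))"], rule exI[of _ "ball 0 r"],
      rule exI[of _ U0], rule exI[of _ Z], rule exI[of _ \<XX>], rule exI[of _ X], auto)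
next
  fix J x \<phi> y \<psi>
  assume kn: "kn_geodesic h U J x \<phi> y \<psi>" and v0: "Complex (deriv x 0) (deriv y 0) \<noteq> 0"
  have J: "open J" "is_interval J" "0 \<in> J" using kn by (auto simp: kn_geodesic_def)
  have "kn_point (x 0) (\<phi> 0) (y 0) (\<psi> 0) \<in> H_KN U h"
    using kn J(3) by (auto simp: kn_geodesic_def geodesic_on_def)
  then have init: "Complex (x 0) (y 0) \<in> U" "Complex (\<phi> 0) (\<psi> 0) \<noteq> 0"
    "(Complex (\<phi> 0) (\<psi> 0))\<^sup>2 \<noteq> h (Complex (x 0) (y 0))"
    by (auto simp: H_KN_def kn_point_def simp del: Complex_eq_0)
  obtain \<epsilon> where \<epsilon>: "\<epsilon> > 0" "ball 0 \<epsilon> \<subseteq> J" using J openE by blast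
  obtain r U0 Z \<XX> X where r: "r \<le> \<epsilon>" "explicit_geodesic h U (ball 0 r) U0 Z \<XX> X"
    "Z 0 = Complex (x 0) (y 0)" "\<XX> 0 = Complex (\<phi> 0) (\<psi> 0)"
    "deriv Z 0 = Complex (deriv x 0) (deriv y 0)" "deriv \<XX> 0 = Complex (deriv \<phi> 0) (deriv \<psi> 0)"
    by (rule explicit_geodesic_exists[OF assms init v0 \<epsilon>(1)]) blast
  have "s \<in> J" if "complex_of_real s \<in> ball 0 r" for s using that r(1) \<epsilon>(2) by auto
  then show "\<exists>V0 U0 Z \<XX> X. convex V0 \<and> explicit_geodesic h U V0 U0 Z \<XX> X \<and>
         same_initial_data Z \<XX> x \<phi> y \<psi> \<and> (\<forall>s. complex_of_real s \<in> V0 \<longrightarrow> s \<in> J)"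
    using r
    by - (rule exI[of _ "ball 0 r"], rule exI[of _ U0], rule exI[of _ Z], rule exI[of _ \<XX>],
      rule exI[of _ X], auto simp: same_initial_data_def)
  fix V0 U0 Z \<XX> X
  assume conv: "convex V0" and expl: "explicit_geodesic h U V0 U0 Z \<XX> X"
    and same: "same_initial_data Z \<XX> x \<phi> y \<psi>"
  interpret explicit_complex_geodesic h U V0 U0 Z \<XX> X
    by standard (use assms conv expl in auto)
  note eq = real_geodesic_eq_complex_geodesic[OF assms kn open_V0 conv zero_V0 geodesic same]
  have e: "Z (of_real s) = Complex (x s) (y s)" "\<XX> (of_real s) = Complex (\<phi> s) (\<psi> s)"
    "X (Complex (x s) (y s)) = Complex (\<phi> s) (\<psi> s)" if "s \<in> J" "complex_of_real s \<in> V0" for s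
    using eq[OF that] XX[OF that(2)] by simp_all
  show "\<exists>\<Phi> \<Psi> :: real \<Rightarrow> real \<Rightarrow> real.
          (\<forall>a b. Complex a b \<in> U0 \<longrightarrow>
             X (Complex a b) = complex_of_real (\<Phi> a b) + \<i> * complex_of_real (\<Psi> a b)) \<and>
          (\<forall>s\<in>J. complex_of_real s \<in> V0 \<longrightarrow>
             x s = Re (Z (of_real s)) \<and> y s = Im (Z (of_real s)) \<and>
             \<Phi> (x s) (y s) = \<phi> s \<and> \<phi> s = Re (\<XX> (of_real s)) \<and>
             \<phi> s = Re (X (Z (of_real s))) \<and>
             \<Psi> (x s) (y s) = \<psi> s \<and> \<psi> s = Im (\<XX> (of_real s)) \<and>
             \<psi> s = Im (X (Z (of_real s))))"
    \<comment> \<open>\<open>\<Phi>\<close> and \<open>\<Psi>\<close> are the real and imaginary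
      parts of \<open>X\<close>; the substance lies in \<open>e\<close>, which identifies the two
      geodesics.\<close>
    by (rule exI[of _ "\<lambda>a b. Re (X (Complex a b))"], rule exI[of _ "\<lambda>a b. Im (X (Complex a b))"],
      auto simp: e complex_eq_iff)
  show "\<forall>t\<in>J. complex_of_real t \<in> V0 \<longrightarrow>
          (\<forall>s\<in>{0..1}. geodesic_path V0 Z (Complex (x t) (y t)) s = Complex (x (t * s)) (y (t * s)))"
  proof (intro ballI impI)
    fix t s :: real assume t: "t \<in> J" "complex_of_real t \<in> V0" and s: "s \<in> {0..1}"
    have "(1 - s) *\<^sub>R 0 + s *\<^sub>R complex_of_real t \<in> V0"
      using conv zero_V0 t s by (intro convexD) auto
    moreover have "t * s \<in> J"
      using J t(1) s convexD[of J 0 t "1 - s" s] by (auto simp: is_interval_convex_1 mult.commute)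
    ultimately have "Z (of_real (t * s)) = Complex (x (t * s)) (y (t * s))"
      by (intro eq) (auto simp: scaleR_conv_of_real mult.commute)
    \<comment> \<open>The point at real time \<open>t\<close> has parameter \<open>t\<close> itself,
      so the path to it retraces the real geodesic from time 0 to time \<open>t\<close>.\<close>
    then show "geodesic_path V0 Z (Complex (x t) (y t)) s = Complex (x (t * s)) (y (t * s))"
      using param_Z[OF t(2)] eq(1)[OF t] by (simp add: geodesic_path_def param_def)
  qed
  show "\<forall>z\<in>U0. X z \<noteq> 0 \<and> h z \<noteq> (X z)\<^sup>2 \<and>
          deriv (deriv X) z =
            (3 * (X z)\<^sup>2 + h z) / ((X z)\<^sup>2 - h z) * ((deriv X z)\<^sup>2 / X z)
            - deriv h z * deriv X z / ((X z)\<^sup>2 - h z)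
            + ((X z) ^ 4 - (h z)\<^sup>2) / X z"
    using X_nonzero h_ne_X2 X_ode by force
  show "\<exists>R. sqrt_branch h U0 X R" by (rule sqrt_branch_exists)
  fix R assume R: "sqrt_branch h U0 X R"
  show "solves_ode h U0 (u_top h X R (geodesic_path V0 Z))"
    by (rule solves_ode_u_top[OF R])
  show "solves_ode h U0 (u_bot h X R (geodesic_path V0 Z))"
    unfolding u_bot_eq by (rule solves_ode_u_top[OF sqrt_branch_uminus[OF R]])
  fix u assume "\<exists>z\<in>U0. discr h X z \<noteq> 0"
  then show "solves_ode h U0 u \<longleftrightarrow>
      (\<exists>A B. \<forall>z\<in>U0. u z = A * u_top h X R (geodesic_path V0 Z) z
                         + B * u_bot h X R (geodesic_path V0 Z) z)"
    using general_solution[OF R] by blast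
qed

end
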